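(* Let $p\ge 4$ be a real number. For any connected graph $G$ of order $n$ with $G\ncong K_n$, we have \[ \mathcal{E}_p^-(G) \ge n.\]
   Context: Graphs are finite, simple and undirected; the order of a graph is its number of vertices, and $K_n$ denotes the complete graph of order $n$. For a graph $G$ of order $n$ with adjacency matrix $A(G)$ having (real) eigenvalues $\lambda_1\ge\cdots\ge\lambda_n$ counted with multiplicity, and a real number $p\ge 1$, the negative $p$-energy of $G$ is \[\mathcal{E}_p^-(G)=\sum_{i:\,\lambda_i<0}|\lambda_i|^p .\] *)

theory Defs
  imports "Graph_Theory.Graph_Theory" "Jordan_Normal_Form.Char_Poly"
begin

text \<open>
  A finite simple undirected graph is a \<open>pair_graph\<close>: a finite vertex set with a symmetric,
  irreflexive arc relation, each undirected edge being the two arcs (u, v) and (v, u).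
  JNF matrices are indexed by natural numbers, so the adjacency matrix takes an enumeration of
  the vertices as argument; it is meaningful when \<open>distinct vs\<close> and \<open>set vs = pverts G\<close>.
  Another enumeration conjugates the matrix by a permutation and so leaves its spectrum unchanged.
\<close>

definition adjacency_matrix :: "'a pair_pre_digraph \<Rightarrow> 'a list \<Rightarrow> real mat" where
  "adjacency_matrix G vs =
     mat (length vs) (length vs) (\<lambda>(i, j). if (vs ! i, vs ! j) \<in> parcs G then 1 else 0)"

text \<open>
  The sum over all eigenvalues with multiplicity is written as a sum over the distinct negative
  eigenvalues, each weighted by its multiplicity as a root of the characteristic polynomial.
\<close>

definition negative_energy :: "real \<Rightarrow> 'a pair_pre_digraph \<Rightarrow> 'a list \<Rightarrow> real" where
  "negative_energy p G vs =
     (let A = adjacency_matrix G vs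
      in \<Sum>x | eigenvalue A x \<and> x < 0. real (Polynomial.order x (char_poly A)) * \<bar>x\<bar> powr p)"

end

theory Submission
  imports Defs "Jordan_Normal_Form.Schur_Decomposition" "HOL-Analysis.Convex"
begin

text \<open>
  Write \<open>f(x) = \<bar>x\<bar>\<^sup>p\<close> for \<open>x < 0\<close> and \<open>f(x) = 0\<close> otherwise, so that the negative energy is the trace of
  \<open>f(A)\<close>. Distributing this trace over the diagonal entries of \<open>f(A)\<close> gives every set \<open>S\<close> of vertices an
  energy, additive over disjoint sets. Because \<open>f\<close> is convex, Jensen's inequality bounds
  \<open>\<langle>u, f(A) u\<rangle>\<close> from below by \<open>s\<^sup>p \<bar>u\<bar>\<^sup>2\<close> whenever \<open>\<langle>u, A u\<rangle> \<le> - s \<bar>u\<bar>\<^sup>2\<close> (\<open>mass_ge\<close>), so mutually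
  orthogonal test vectors supported on \<open>S\<close> bound the energy of \<open>S\<close>.

  Differences of unit vectors give a clique \<open>C\<close> energy at least \<open>card C - 1\<close>, just one less than the
  target. A blow-up of a small graph, each of whose vertices is replaced by a clique, gains in addition a
  vector that is constant on the classes and reproduces the least eigenvalue of the small graph
  (\<open>energy_blow_up\<close>). Stars and the path on four vertices suffice to show that a vertex attached to
  pairwise non-adjacent cliques spans energy at least its number of vertices plus one, unless it is
  complete (\<open>energy_windmill\<close>); this is where \<open>p \<ge> 4\<close> enters.

  A connected non-complete set of vertices either splits into two smaller connected non-complete sets, or
  consists of a clique, which loses one, and a windmill as above, which gains one
  (\<open>energy_connected_noncomplete\<close>). Induction then yields the theorem.
\<close>

section \<open>The spectral theorem for real symmetric matrices\<close>

text \<open>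
  A complex eigenvalue \<open>a\<close> with eigenvector \<open>v\<close> is real: the number
  \<open>v\<^sup>* A v = a \<bar>v\<bar>\<^sup>2\<close> equals its own conjugate, since \<open>A\<close> is real and symmetric.
\<close>
lemma real_symmetric_has_eigenvalue:
  fixes A :: "real mat"
  assumes A: "A \<in> carrier_mat n n" and sym: "transpose_mat A = A" and n: "n > 0"
  shows "\<exists>e. eigenvalue A e"
proof -
  let ?B = "map_mat complex_of_real A"
  have B: "?B \<in> carrier_mat n n" using A by simp
  have "degree (char_poly ?B) = n" using degree_monic_char_poly[OF B] by simp
  then have "\<not> constant (poly (char_poly ?B))" using n by (simp add: constant_degree)
  then obtain a where a: "poly (char_poly ?B) a = 0" using fundamental_theorem_of_algebra by blast
  then have "eigenvalue ?B a" using eigenvalue_root_char_poly[OF B] by simp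
  then obtain v where v: "v \<in> carrier_vec n" "v \<noteq> 0\<^sub>v n" "?B *\<^sub>v v = a \<cdot>\<^sub>v v"
    unfolding eigenvalue_def eigenvector_def using A by auto
  have symi: "A $$ (i, k) = A $$ (k, i)" if "i < n" "k < n" for i k
    using arg_cong[OF sym, of "\<lambda>M. M $$ (i, k)"] that A by simp
  have ev: "(\<Sum>k<n. A $$ (i, k) * v $ k) = a * v $ i" if "i < n" for i
    using arg_cong[OF v(3), of "\<lambda>w. w $ i"] that A v(1)
    by (simp add: scalar_prod_def atLeast0LessThan)
  define S where "S = (\<Sum>i<n. \<Sum>k<n. complex_of_real (A $$ (i, k)) * v $ k * cnj (v $ i))"
  have S1: "S = a * (\<Sum>i<n. v $ i * cnj (v $ i))"
    unfolding S_def sum_distrib_left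
    by (rule sum.cong) (auto simp: ev[symmetric] sum_distrib_right mult.assoc[symmetric])
  have "cnj S = (\<Sum>i<n. \<Sum>k<n. complex_of_real (A $$ (k, i)) * v $ i * cnj (v $ k))"
    unfolding S_def by (auto simp: symi intro!: sum.cong)
  also have "\<dots> = S" unfolding S_def by (rule sum.swap)
  finally have "cnj S = S" .
  define N where "N = (\<Sum>i<n. (cmod (v $ i))\<^sup>2)"
  have N: "(\<Sum>i<n. v $ i * cnj (v $ i)) = complex_of_real N"
    unfolding N_def of_real_sum by (rule sum.cong) (simp_all add: complex_norm_square[symmetric] del: of_real_power)
  obtain i where i: "i < n" "v $ i \<noteq> 0" using v(1,2) by (metis eq_vecI carrier_vecD index_zero_vec)
  have "N > 0" unfolding N_def using i by (intro sum_pos2[of _ i]) auto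
  then have "cnj a = a" using \<open>cnj S = S\<close> unfolding S1 N by simp
  then have aR: "a = complex_of_real (Re a)" by (simp add: complex_eq_iff)
  have "complex_of_real (poly (char_poly A) (Re a)) = poly (char_poly ?B) (complex_of_real (Re a))"
    by (simp add: of_real_hom.char_poly_hom[OF A])
  also have "\<dots> = 0" using a aR by simp
  finally have "poly (char_poly A) (Re a) = 0" by simp
  then show ?thesis using eigenvalue_root_char_poly[OF A] by blast
qed

text \<open>
  Gram-Schmidt keeps the direction of the first vector of a basis, so normalising its output gives
  an orthogonal matrix whose first column is a multiple of \<open>v\<close>.
\<close>
lemma orthonormal_completion:
  fixes v :: "real vec"
  assumes v: "v \<in> carrier_vec n" "v \<noteq> 0\<^sub>v n"
  shows "\<exists>W c. W \<in> carrier_mat n n \<and> transpose_mat W * W = 1\<^sub>m n \<and> col W 0 = c \<cdot>\<^sub>v v"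
proof -
  have n: "n > 0" using v by (cases n) auto
  interpret cof_vec_space n "TYPE(real)" .
  define ws where "ws = gram_schmidt n (basis_completion v)"
  note b = basis_completion[OF v]
  obtain us where us: "basis_completion v = v # us" using b(6) b(7) n
    by (metis length_greater_0_conv list.exhaust list.sel(1))
  from gram_schmidt_result[OF b(2) b(4) b(5) refl, folded ws_def] b(6)
  have ws: "set ws \<subseteq> carrier_vec n" "corthogonal ws" "length ws = n" by auto
  have hd: "ws ! 0 = v" unfolding ws_def us using gram_schmidt_hd[OF v(1)] ws(3) n
    by (metis hd_conv_nth length_greater_0_conv ws_def us)
  define r where "r i = inverse (sqrt (ws ! i \<bullet> ws ! i))" for i
  define W where "W = mat_of_cols n (map (\<lambda>i. r i \<cdot>\<^sub>v (ws ! i)) [0..<n])"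
  have wsc: "ws ! i \<in> carrier_vec n" if "i < n" for i using ws that by auto
  have W: "W \<in> carrier_mat n n" unfolding W_def by auto
  have colW: "col W i = r i \<cdot>\<^sub>v (ws ! i)" if "i < n" for i
    unfolding W_def using that wsc[OF that] by (subst col_mat_of_cols) auto
  have orth: "(ws ! i \<bullet> ws ! k = 0) = (i \<noteq> k)" if "i < n" "k < n" for i k
    using corthogonalD[OF ws(2)] that ws(3) by simp
  have pos: "ws ! i \<bullet> ws ! i > 0" if "i < n" for i
    using orth[OF that that] sum_nonneg[of "{0..<dim_vec (ws ! i)}" "\<lambda>k. ws ! i $ k * ws ! i $ k"]
    by (simp add: scalar_prod_def less_le)
  have "transpose_mat W * W = 1\<^sub>m n"
  proof (rule eq_matI)
    fix i k assume "i < dim_row (1\<^sub>m n)" "k < dim_col (1\<^sub>m n)"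
    then have ik: "i < n" "k < n" by auto
    have "(transpose_mat W * W) $$ (i, k) = r i * r k * (ws ! i \<bullet> ws ! k)"
      using ik W wsc[OF ik(1)] wsc[OF ik(2)] by (simp add: colW)
    also have "\<dots> = 1\<^sub>m n $$ (i, k)"
      using orth[OF ik] pos[OF ik(1)] ik
      by (auto simp: r_def power2_eq_square[symmetric] power_inverse)
    finally show "(transpose_mat W * W) $$ (i, k) = 1\<^sub>m n $$ (i, k)" .
  qed (use W in auto)
  then show ?thesis using W colW[OF n] hd by metis
qed

text \<open>
  Deflation: in an orthonormal basis starting with an eigenvector, the first column of the matrix is
  a multiple of the first unit vector, hence by symmetry so is the first row, and the induction
  hypothesis diagonalises the remaining block.
\<close>
theorem real_spectral:
  fixes A :: "real mat"
  assumes "A \<in> carrier_mat n n" and "transpose_mat A = A"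
  shows "\<exists>P es. P \<in> carrier_mat n n \<and> length es = n \<and> transpose_mat P * P = 1\<^sub>m n \<and>
     A = P * mat n n (\<lambda>(i, j). if i = j then es ! i else 0) * transpose_mat P"
  using assms
proof (induction n arbitrary: A)
  case 0
  show ?case
    by (rule exI[of _ "1\<^sub>m 0"], rule exI[of _ "[]"]) (use 0 in \<open>auto intro!: eq_matI\<close>)
next
  case (Suc m A)
  let ?n = "Suc m"
  have A: "A \<in> carrier_mat ?n ?n" and sym: "transpose_mat A = A" using Suc.prems by auto
  obtain e v where "eigenvector A v e"
    using real_symmetric_has_eigenvalue[OF A sym] unfolding eigenvalue_def by auto
  then have v: "v \<in> carrier_vec ?n" "v \<noteq> 0\<^sub>v ?n" and ev: "A *\<^sub>v v = e \<cdot>\<^sub>v v"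
    using A unfolding eigenvector_def by auto
  obtain W c where W: "W \<in> carrier_mat ?n ?n" and WW: "transpose_mat W * W = 1\<^sub>m ?n"
    and col0: "col W 0 = c \<cdot>\<^sub>v v" using orthonormal_completion[OF v] by blast
  have Wt: "transpose_mat W \<in> carrier_mat ?n ?n" using W by simp
  have WW': "W * transpose_mat W = 1\<^sub>m ?n" using mat_mult_left_right_inverse[OF Wt W WW] .
  define A' where "A' = transpose_mat W * A * W"
  have A': "A' \<in> carrier_mat ?n ?n" using A W by (simp add: A'_def)
  have symA': "transpose_mat A' = A'"
    unfolding A'_def using A W sym
    by (simp add: transpose_mult[of _ ?n ?n _ ?n] assoc_mult_mat[of _ ?n ?n _ ?n _ ?n])
  have symi: "A' $$ (i, k) = A' $$ (k, i)" if "i < ?n" "k < ?n" for i k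
    using arg_cong[OF symA', of "\<lambda>M. M $$ (i, k)"] that A' by simp
  have "A' = transpose_mat W * (A * W)" unfolding A'_def using A W Wt by (simp add: assoc_mult_mat)
  then have "col A' 0 = transpose_mat W *\<^sub>v (A *\<^sub>v col W 0)"
    using col_mult2[OF Wt, of "A * W" ?n 0] col_mult2[OF A W, of 0] A W by simp
  also have "A *\<^sub>v col W 0 = e \<cdot>\<^sub>v col W 0"
    unfolding col0 using A v ev by (simp add: mult_mat_vec[of _ ?n ?n] smult_smult_assoc mult.commute)
  also have "transpose_mat W *\<^sub>v (e \<cdot>\<^sub>v col W 0) = e \<cdot>\<^sub>v col (transpose_mat W * W) 0"
    using col_mult2[OF Wt W, of 0] mult_mat_vec[OF Wt, of "col W 0" e] W by (simp add: carrier_vecI)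
  finally have colA': "col A' 0 = e \<cdot>\<^sub>v unit_vec ?n 0" by (simp add: WW)
  have A'0: "A' $$ (i, 0) = (if i = 0 then e else 0)" if "i < ?n" for i
    using arg_cong[OF colA', of "\<lambda>w. w $ i"] that A' by (simp add: unit_vec_def)
  define A3 where "A3 = mat m m (\<lambda>(i, k). A' $$ (Suc i, Suc k))"
  have A3: "A3 \<in> carrier_mat m m" by (simp add: A3_def)
  have "transpose_mat A3 = A3" by (rule eq_matI) (auto simp: A3_def symi)
  from Suc.IH[OF A3 this] obtain P' es where P': "P' \<in> carrier_mat m m" "length es = m"
    "transpose_mat P' * P' = 1\<^sub>m m"
    and A3P: "A3 = P' * mat m m (\<lambda>(i, j). if i = j then es ! i else 0) * transpose_mat P'" by blast
  define D' where "D' = mat m m (\<lambda>(i, j). if i = j then es ! i else 0)"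
  have D': "D' \<in> carrier_mat m m" by (simp add: D'_def)
  define E where "E = mat 1 1 (\<lambda>_. e)"
  have E: "E \<in> carrier_mat 1 1" by (simp add: E_def)
  define D where "D = mat ?n ?n (\<lambda>(i, j). if i = j then (e # es) ! i else 0)"
  have D: "D \<in> carrier_mat ?n ?n" by (simp add: D_def)
  have Dblock: "D = four_block_mat E (0\<^sub>m 1 m) (0\<^sub>m m 1) D'"
    by (rule eq_matI) (auto simp: D_def D'_def E_def nth_Cons split: nat.split)
  have A'block: "A' = four_block_mat E (0\<^sub>m 1 m) (0\<^sub>m m 1) A3"
    by (rule eq_matI) (use A' A'0 symi in \<open>auto simp: A3_def E_def split: nat.split\<close>)
  define Q where "Q = four_block_mat (1\<^sub>m 1) (0\<^sub>m 1 m) (0\<^sub>m m 1) P'"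
  have Q: "Q \<in> carrier_mat ?n ?n" using P' by (auto simp: Q_def)
  have Qt: "transpose_mat Q = four_block_mat (1\<^sub>m 1) (0\<^sub>m 1 m) (0\<^sub>m m 1) (transpose_mat P')"
    unfolding Q_def using P'(1)
    by (subst transpose_four_block_mat[of _ 1 1 _ m _ m]) auto
  have "transpose_mat Q * Q = four_block_mat (1\<^sub>m 1) (0\<^sub>m 1 m) (0\<^sub>m m 1) (1\<^sub>m m)"
    unfolding Qt unfolding Q_def using P'
    by (subst mult_four_block_mat[of _ 1 1 _ m _ m _ _ 1 _ m]) auto
  also have "\<dots> = 1\<^sub>m ?n" by (rule eq_matI) auto
  finally have QQ: "transpose_mat Q * Q = 1\<^sub>m ?n" .
  have "Q * D = four_block_mat E (0\<^sub>m 1 m) (0\<^sub>m m 1) (P' * D')"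
    unfolding Dblock Q_def using P' D' E
    by (subst mult_four_block_mat[of _ 1 1 _ m _ m _ _ 1 _ m]) auto
  then have "Q * D * transpose_mat Q = four_block_mat E (0\<^sub>m 1 m) (0\<^sub>m m 1) (P' * D' * transpose_mat P')"
    unfolding Qt using P' D' E
    by (simp, subst mult_four_block_mat[of _ 1 1 _ m _ m _ _ 1 _ m]) auto
  then have A'Q: "A' = Q * D * transpose_mat Q"
    unfolding A'block A3P D'_def[symmetric] by simp
  have "W * A' * transpose_mat W = (W * transpose_mat W) * A * (W * transpose_mat W)"
    unfolding A'_def using A W by (simp add: assoc_mult_mat[of _ ?n ?n _ ?n _ ?n])
  then have "A = W * A' * transpose_mat W" using A by (simp add: WW')
  also have "\<dots> = (W * Q) * D * transpose_mat (W * Q)"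
    unfolding A'Q using W Q D
    by (simp add: transpose_mult[of _ ?n ?n _ ?n] assoc_mult_mat[of _ ?n ?n _ ?n _ ?n])
  finally have AP: "A = (W * Q) * D * transpose_mat (W * Q)" .
  have "transpose_mat (W * Q) * (W * Q) = transpose_mat Q * (transpose_mat W * W) * Q"
    using W Q by (simp add: transpose_mult[of _ ?n ?n _ ?n] assoc_mult_mat[of _ ?n ?n _ ?n _ ?n])
  also have "\<dots> = 1\<^sub>m ?n" using Q QQ by (simp add: WW)
  finally have PP: "transpose_mat (W * Q) * (W * Q) = 1\<^sub>m ?n" .
  show ?case
    by (rule exI[of _ "W * Q"], rule exI[of _ "e # es"])
      (use W Q P'(2) PP AP in \<open>simp add: D_def\<close>)
qed

lemma order_prod_linear:
  fixes x :: real
  shows "Polynomial.order x (\<Prod>e\<leftarrow>es. [:- e, 1:]) = count_list es x"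
proof (induction es)
  case (Cons e es)
  have "(\<Prod>e\<leftarrow>es. [:- e, 1:]) \<noteq> 0" by (auto simp: prod_list_zero_iff)
  then show ?case using Cons
    by (simp add: order_mult order_linear' del: mult_pCons_left)
qed (simp add: order_1_eq_0)

lemma sum_list_map_eq_sum_count_weighted:
  fixes f :: "'b \<Rightarrow> real"
  shows "sum_list (map f xs) = (\<Sum>x\<in>set xs. real (count_list xs x) * f x)"
proof -
  have "sum_list (map f xs) = (\<Sum>x\<in>S. real (count_list xs x) * f x)" if "finite S" "set xs \<subseteq> S" for S
    using that
  proof (induction xs)
    case (Cons y xs)
    have "(\<Sum>x\<in>S. real (count_list (y # xs) x) * f x)
      = (\<Sum>x\<in>S. (if x = y then f x else 0) + real (count_list xs x) * f x)"
      by (rule sum.cong) (auto simp: algebra_simps)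
    then show ?case using Cons by (simp add: sum.distrib)
  qed simp
  then show ?thesis by blast
qed

text \<open>
  This turns a sum over distinct eigenvalues weighted by their multiplicities, the form in which the
  energy is given, into a sum over a list of all eigenvalues.
\<close>
lemma sum_order_char_poly:
  fixes A :: "real mat" and f :: "real \<Rightarrow> real"
  assumes A: "A \<in> carrier_mat n n" and cp: "char_poly A = (\<Prod>e\<leftarrow>es. [:- e, 1:])"
  shows "(\<Sum>x | eigenvalue A x \<and> P x. real (Polynomial.order x (char_poly A)) * f x)
    = (\<Sum>j<length es. if P (es ! j) then f (es ! j) else 0)"
proof -
  have ev: "eigenvalue A x \<longleftrightarrow> x \<in> set es" for x
    unfolding eigenvalue_root_char_poly[OF A] cp by (induction es) auto
  let ?g = "\<lambda>x. if P x then f x else 0"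
  have "(\<Sum>x | eigenvalue A x \<and> P x. real (Polynomial.order x (char_poly A)) * f x)
    = (\<Sum>x\<in>set es. real (count_list es x) * ?g x)"
    unfolding cp order_prod_linear ev by (rule sum.mono_neutral_cong_left) auto
  also have "\<dots> = sum_list (map ?g es)" by (simp add: sum_list_map_eq_sum_count_weighted)
  also have "\<dots> = (\<Sum>j<length es. ?g (es ! j))"
    by (simp add: sum_list_sum_nth atLeast0LessThan)
  finally show ?thesis .
qed

text \<open>
  The spectral theorem written entrywise, with \<open>P i j\<close> the \<open>i\<close>-th coordinate of the \<open>j\<close>-th
  eigenvector; the list of eigenvalues is the multiset of roots of the characteristic polynomial.
\<close>
lemma symmetric_spectral_sums:
  fixes A :: "real mat"
  assumes A: "A \<in> carrier_mat n n" and sym: "transpose_mat A = A"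
  obtains P es where "length es = n"
    "char_poly A = (\<Prod>e\<leftarrow>es. [:- e, 1:])"
    "\<And>i k. i < n \<Longrightarrow> k < n \<Longrightarrow> (\<Sum>j<n. P i j * P k j) = (if i = k then 1 else 0 :: real)"
    "\<And>j. j < n \<Longrightarrow> (\<Sum>i<n. (P i j)\<^sup>2) = 1"
    "\<And>i k. i < n \<Longrightarrow> k < n \<Longrightarrow> A $$ (i, k) = (\<Sum>j<n. es ! j * (P i j * P k j))"
proof -
  obtain P es where P: "P \<in> carrier_mat n n" and es: "length es = n"
    and PP: "transpose_mat P * P = 1\<^sub>m n"
    and AP: "A = P * mat n n (\<lambda>(i, j). if i = j then es ! i else 0) * transpose_mat P"
    using real_spectral[OF A sym] by blast
  define D where "D = mat n n (\<lambda>(i, j). if i = j then es ! i else 0)"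
  have D: "D \<in> carrier_mat n n" by (simp add: D_def)
  have Pt: "transpose_mat P \<in> carrier_mat n n" using P by simp
  have PP': "P * transpose_mat P = 1\<^sub>m n" using mat_mult_left_right_inverse[OF Pt P PP] .
  have "similar_mat_wit A D P (transpose_mat P)"
    by (rule similar_mat_witI[of _ _ n]) (use P A D PP PP' AP in \<open>auto simp: D_def\<close>)
  then have "char_poly A = char_poly D" by (intro char_poly_similar) (auto simp: similar_mat_def)
  also have "\<dots> = (\<Prod>e\<leftarrow>diag_mat D. [:- e, 1:])"
    by (rule char_poly_upper_triangular[OF D]) (auto simp: D_def)
  also have "diag_mat D = es" by (rule nth_equalityI) (auto simp: diag_mat_def D_def es)
  finally have cp: "char_poly A = (\<Prod>e\<leftarrow>es. [:- e, 1:])" .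
  have rows: "(\<Sum>j<n. P $$ (i, j) * P $$ (k, j)) = (if i = k then 1 else 0)"
    if "i < n" "k < n" for i k
    using arg_cong[OF PP', of "\<lambda>M. M $$ (i, k)"] that P by (simp add: scalar_prod_def atLeast0LessThan)
  have cols: "(\<Sum>i<n. (P $$ (i, j))\<^sup>2) = 1" if "j < n" for j
    using arg_cong[OF PP, of "\<lambda>M. M $$ (j, j)"] that P
    by (simp add: scalar_prod_def atLeast0LessThan power2_eq_square)
  have PD: "(P * D) $$ (i, j) = es ! j * P $$ (i, j)" if "i < n" "j < n" for i j
  proof -
    have "(P * D) $$ (i, j) = (\<Sum>l<n. P $$ (i, l) * (if l = j then es ! l else 0))"
      using that P D by (simp add: scalar_prod_def atLeast0LessThan D_def)
    also have "\<dots> = (\<Sum>l<n. if l = j then P $$ (i, l) * es ! l else 0)"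
      by (rule sum.cong) auto
    finally show ?thesis using that by (simp add: mult.commute)
  qed
  have entries: "A $$ (i, k) = (\<Sum>j<n. es ! j * (P $$ (i, j) * P $$ (k, j)))"
    if "i < n" "k < n" for i k
  proof -
    have "A $$ (i, k) = (\<Sum>j<n. (P * D) $$ (i, j) * P $$ (k, j))"
      by (subst AP[folded D_def]) (use that P D in \<open>simp add: scalar_prod_def atLeast0LessThan del: assoc_mult_mat\<close>)
    then show ?thesis using that by (simp add: PD mult.assoc)
  qed
  show ?thesis
    by (rule that[of es "\<lambda>i j. P $$ (i, j)"]) (use es cp rows cols entries in auto)
qed

section \<open>Energies of vertex sets and test vectors\<close>

text \<open>
  This is \<open>f(x) = \<bar>x\<bar>\<^sup>p\<close> for negative \<open>x\<close> and \<open>0\<close> otherwise: as \<open>0 powr p = 0\<close>, the maximum also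
  covers the second case. The negative energy is the trace of \<open>f(A)\<close>.
\<close>
definition neg_power :: "real \<Rightarrow> real \<Rightarrow> real" where
  "neg_power p x = (max 0 (- x)) powr p"

lemma neg_power_nonneg: "neg_power p x \<ge> 0"
  by (simp add: neg_power_def)

text \<open>
  The convexity of \<open>f\<close> enters through its tangent line at \<open>- s\<close>. For negative \<open>x\<close> this is the weighted
  AM-GM inequality for \<open>\<bar>x\<bar>\<^sup>p\<close> and \<open>s\<^sup>p\<close> with weights \<open>1/p\<close> and \<open>1 - 1/p\<close>; for the other \<open>x\<close> the
  tangent line is not positive.
\<close>
lemma neg_power_above_tangent:
  assumes p: "p \<ge> 1" and s: "s > 0"
  shows "neg_power p x \<ge> s powr p + p * s powr (p - 1) * (- x - s)"
proof (cases "x < 0")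
  case True
  define t where "t = - x"
  have t: "t > 0" using True by (simp add: t_def)
  have "(t powr p) powr (1 / p) * (s powr p) powr (1 - 1 / p) \<le> 1 / p * t powr p + (1 - 1 / p) * s powr p"
    by (rule Youngs_inequality_0) (use p s t in auto)
  then have "t * s powr (p - 1) \<le> 1 / p * t powr p + (1 - 1 / p) * s powr p"
    using p s t by (simp add: powr_powr algebra_simps)
  then have "p * (t * s powr (p - 1)) \<le> p * (1 / p * t powr p + (1 - 1 / p) * s powr p)"
    using p by (intro mult_left_mono) auto
  also have "\<dots> = t powr p + (p - 1) * s powr p" using p by (simp add: field_simps)
  finally have "p * (t * s powr (p - 1)) \<le> t powr p + (p - 1) * s powr p" .
  moreover have "s powr (p - 1) * s = s powr p" using s by (simp add: powr_diff)
  ultimately show ?thesis using t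
    by (simp add: neg_power_def t_def[symmetric] algebra_simps)
next
  case False
  have "s powr (p - 1) * s = s powr p" using s by (simp add: powr_diff)
  then have "s powr p + p * s powr (p - 1) * (- x - s) = s powr p * (1 - p) - p * s powr (p - 1) * x"
    by (simp add: algebra_simps)
  also have "\<dots> \<le> 0"
  proof -
    have "s powr p * (1 - p) \<le> 0" using p by (intro mult_nonneg_nonpos) auto
    moreover have "p * s powr (p - 1) * x \<ge> 0" using p False by (intro mult_nonneg_nonneg) auto
    ultimately show ?thesis by linarith
  qed
  finally show ?thesis using neg_power_nonneg[of p x] by linarith
qed

text \<open>
  On a set of \<open>c\<close> coordinates, the identity splits \<open>c\<close> times the squared length of \<open>y\<close> into the part
  orthogonal to the all-ones vector, spanned by differences of unit vectors, and the part along it.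
\<close>
lemma sum_square_differences:
  fixes y :: "'a \<Rightarrow> real"
  shows "(\<Sum>a\<in>C. \<Sum>b\<in>C. (y a - y b)\<^sup>2) / 2 + (\<Sum>a\<in>C. y a)\<^sup>2 = real (card C) * (\<Sum>a\<in>C. (y a)\<^sup>2)"
proof -
  have "(\<Sum>a\<in>C. \<Sum>b\<in>C. (y a - y b)\<^sup>2)
    = (\<Sum>a\<in>C. real (card C) * (y a)\<^sup>2 + (\<Sum>b\<in>C. (y b)\<^sup>2) - 2 * (y a * (\<Sum>b\<in>C. y b)))"
    by (simp add: power2_diff sum.distrib sum_subtractf sum_distrib_left mult.assoc)
  also have "\<dots> = 2 * (real (card C) * (\<Sum>a\<in>C. (y a)\<^sup>2)) - 2 * (\<Sum>a\<in>C. y a)\<^sup>2"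
    by (simp add: sum.distrib sum_subtractf sum_distrib_left[symmetric] sum_distrib_right[symmetric] power2_eq_square)
  finally show ?thesis by linarith
qed

text \<open>
  A graph together with a spectral decomposition of its adjacency matrix \<open>A\<close>. The vectors \<open>e j\<close> are
  thought of as an orthonormal basis of eigenvectors with eigenvalues \<open>lam j\<close>; this enters only through
  Parseval's identity and the diagonal form of \<open>\<langle>u, A u\<rangle>\<close>.
\<close>
locale spectral_graph =
  fixes V :: "'a set" and adj :: "'a \<Rightarrow> 'a \<Rightarrow> bool"
    and J :: "'j set" and e :: "'j \<Rightarrow> 'a \<Rightarrow> real" and lam :: "'j \<Rightarrow> real" and p :: real
  assumes finite_V: "finite V"
    and adj_sym: "adj a b \<Longrightarrow> adj b a" and adj_irrefl: "\<not> adj a a"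
    and p4: "p \<ge> 4"
    and parseval: "\<And>u. (\<Sum>v\<in>V. (u v)\<^sup>2) = (\<Sum>j\<in>J. (\<Sum>v\<in>V. u v * e j v)\<^sup>2)"
    and diagonal: "\<And>u. (\<Sum>v\<in>V. \<Sum>w\<in>V. of_bool (adj v w) * u v * u w)
      = (\<Sum>j\<in>J. lam j * (\<Sum>v\<in>V. u v * e j v)\<^sup>2)"
begin

text \<open>
  The quadratic form \<open>\<langle>u, f(A) u\<rangle>\<close>.
\<close>
definition mass :: "('a \<Rightarrow> real) \<Rightarrow> real" where
  "mass u = (\<Sum>j\<in>J. neg_power p (lam j) * (\<Sum>v\<in>V. u v * e j v)\<^sup>2)"

text \<open>
  The part of the trace of \<open>f(A)\<close> carried by the vertices of \<open>S\<close>, where \<open>A\<close> is always the matrix of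
  the whole graph and not that of the subgraph induced by \<open>S\<close>. With this choice additivity over
  disjoint sets is an equality, while the lower bounds depend only on the edges inside \<open>S\<close>.
\<close>
definition energy :: "'a set \<Rightarrow> real" where
  "energy S = (\<Sum>v\<in>S. \<Sum>j\<in>J. neg_power p (lam j) * (e j v)\<^sup>2)"

definition clique :: "'a set \<Rightarrow> bool" where
  "clique S \<longleftrightarrow> (\<forall>a\<in>S. \<forall>b\<in>S. a \<noteq> b \<longrightarrow> adj a b)"

lemma clique_subset: "clique S \<Longrightarrow> T \<subseteq> S \<Longrightarrow> clique T"
  unfolding clique_def by blast

lemma energy_nonneg: "energy S \<ge> 0"
  unfolding energy_def by (intro sum_nonneg mult_nonneg_nonneg neg_power_nonneg) auto

lemma energy_Un: "S \<subseteq> V \<Longrightarrow> T \<subseteq> V \<Longrightarrow> S \<inter> T = {} \<Longrightarrow> energy (S \<union> T) = energy S + energy T"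
  unfolding energy_def by (intro sum.union_disjoint) (auto intro: finite_subset[OF _ finite_V])

lemma energy_UN:
  assumes "finite I" "\<And>i. i \<in> I \<Longrightarrow> C i \<subseteq> V" "\<And>i k. i \<in> I \<Longrightarrow> k \<in> I \<Longrightarrow> i \<noteq> k \<Longrightarrow> C i \<inter> C k = {}"
  shows "energy (\<Union>i\<in>I. C i) = (\<Sum>i\<in>I. energy (C i))"
  unfolding energy_def using assms by (intro sum.UNION_disjoint) (auto intro: finite_subset[OF _ finite_V])

lemma energy_alt: "energy S = (\<Sum>j\<in>J. neg_power p (lam j) * (\<Sum>v\<in>S. (e j v)\<^sup>2))"
  unfolding energy_def by (subst sum.swap) (simp add: sum_distrib_left)

text \<open>
  Jensen's inequality for the spectral measure of \<open>u\<close>, whose total weight is \<open>\<bar>u\<bar>\<^sup>2\<close>: summing the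
  tangent line bound over the eigenvalues leaves \<open>s\<^sup>p \<bar>u\<bar>\<^sup>2\<close> plus a nonnegative multiple of
  \<open>- \<langle>u, A u\<rangle> - s \<bar>u\<bar>\<^sup>2\<close>. Every lower bound on energies comes from test vectors inserted here.
\<close>
lemma mass_ge:
  assumes s: "s > 0"
    and q: "(\<Sum>v\<in>V. \<Sum>w\<in>V. of_bool (adj v w) * u v * u w) \<le> - s * (\<Sum>v\<in>V. (u v)\<^sup>2)"
  shows "mass u \<ge> s powr p * (\<Sum>v\<in>V. (u v)\<^sup>2)"
proof -
  define c where "c j = (\<Sum>v\<in>V. u v * e j v)\<^sup>2" for j
  have c: "c j \<ge> 0" for j by (simp add: c_def)
  have "s powr p * (\<Sum>j\<in>J. c j) + p * s powr (p - 1) * (- (\<Sum>j\<in>J. lam j * c j) - s * (\<Sum>j\<in>J. c j))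
    = (\<Sum>j\<in>J. (s powr p + p * s powr (p - 1) * (- lam j - s)) * c j)"
  proof -
    have "(s powr p + p * s powr (p - 1) * (- lam j - s)) * c j
      = s powr p * c j + p * s powr (p - 1) * (- (lam j * c j) - s * c j)" for j
      by (simp add: algebra_simps)
    then show ?thesis
      by (simp add: sum.distrib sum_subtractf sum_negf sum_distrib_left[symmetric])
  qed
  also have "\<dots> \<le> (\<Sum>j\<in>J. neg_power p (lam j) * c j)"
    using p4 s c by (intro sum_mono mult_right_mono neg_power_above_tangent) auto
  also have "\<dots> = mass u" by (simp add: mass_def c_def)
  finally have *: "s powr p * (\<Sum>j\<in>J. c j)
    + p * s powr (p - 1) * (- (\<Sum>j\<in>J. lam j * c j) - s * (\<Sum>j\<in>J. c j)) \<le> mass u" .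
  have "(\<Sum>j\<in>J. lam j * c j) \<le> - s * (\<Sum>j\<in>J. c j)"
    using q unfolding diagonal parseval c_def .
  then have "p * s powr (p - 1) * (- (\<Sum>j\<in>J. lam j * c j) - s * (\<Sum>j\<in>J. c j)) \<ge> 0"
    using p4 by (intro mult_nonneg_nonneg) auto
  with * show ?thesis unfolding parseval c_def by linarith
qed

text \<open>
  The test vector is the difference of two unit vectors, with \<open>\<langle>u, A u\<rangle> = - 2\<close> and
  \<open>\<bar>u\<bar>\<^sup>2 = 2\<close>, so that \<open>s = 1\<close>.
\<close>
lemma mass_edge:
  assumes ab: "a \<in> V" "b \<in> V" "adj a b"
  shows "(\<Sum>j\<in>J. neg_power p (lam j) * (e j a - e j b)\<^sup>2) \<ge> 2"
proof -
  define u where "u v = (of_bool (v = a) - of_bool (v = b) :: real)" for v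
  have ne: "a \<noteq> b" using ab(3) adj_irrefl by auto
  have inner: "(\<Sum>v\<in>V. u v * g v) = g a - g b" for g
  proof -
    have "(\<Sum>v\<in>V. u v * g v) = (\<Sum>v\<in>V. (if v = a then g v else 0) - (if v = b then g v else 0))"
      by (rule sum.cong) (auto simp: u_def)
    then show ?thesis using ab finite_V by (simp add: sum_subtractf)
  qed
  have norm: "(\<Sum>v\<in>V. (u v)\<^sup>2) = 2"
    using inner[of u] ne by (simp add: power2_eq_square) (simp add: u_def)
  have "(\<Sum>v\<in>V. \<Sum>w\<in>V. of_bool (adj v w) * u v * u w) = (\<Sum>v\<in>V. u v * (\<Sum>w\<in>V. u w * of_bool (adj v w)))"
    by (simp add: sum_distrib_left mult_ac)
  also have "\<dots> = - 2"
    unfolding inner using ab(3) adj_sym[OF ab(3)] adj_irrefl by simp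
  finally have "mass u \<ge> 1 powr p * 2"
    using mass_ge[of 1 u] norm by simp
  then show ?thesis by (simp add: mass_def inner)
qed

text \<open>
  The differences of unit vectors inside a clique account for \<open>card C - 1\<close>, the negative energy of a
  complete graph. What remains is the contribution of the normalised indicator vector of \<open>C\<close>; keeping
  it allows vectors that are constant on several cliques to be tested in addition.
\<close>
lemma energy_clique_surplus:
  assumes C: "C \<subseteq> V" "clique C" "C \<noteq> {}"
  shows "energy C \<ge> real (card C) - 1
    + (\<Sum>j\<in>J. neg_power p (lam j) * ((\<Sum>v\<in>C. e j v)\<^sup>2 / real (card C)))"
proof -
  have fin: "finite C" using C(1) finite_V finite_subset by blast
  let ?c = "real (card C)"
  have c: "?c > 0" using fin C(3) by (simp add: card_gt_0_iff)
  let ?X = "\<Sum>j\<in>J. neg_power p (lam j) * (\<Sum>v\<in>C. e j v)\<^sup>2"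
  let ?D = "\<lambda>a b. \<Sum>j\<in>J. neg_power p (lam j) * (e j a - e j b)\<^sup>2"
  have "?c * energy C = (\<Sum>j\<in>J. neg_power p (lam j) * (?c * (\<Sum>v\<in>C. (e j v)\<^sup>2)))"
    by (simp add: energy_alt sum_distrib_left mult_ac)
  also have "\<dots> = (\<Sum>j\<in>J. neg_power p (lam j) * (\<Sum>a\<in>C. \<Sum>b\<in>C. (e j a - e j b)\<^sup>2)) / 2 + ?X"
    by (simp add: sum_square_differences[symmetric] distrib_left sum.distrib sum_divide_distrib[of _ J])
  also have "(\<Sum>j\<in>J. neg_power p (lam j) * (\<Sum>a\<in>C. \<Sum>b\<in>C. (e j a - e j b)\<^sup>2)) = (\<Sum>a\<in>C. \<Sum>b\<in>C. ?D a b)"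
    by (simp add: sum_distrib_left sum.swap[of _ _ J])
  finally have eq: "?c * energy C = (\<Sum>a\<in>C. \<Sum>b\<in>C. ?D a b) / 2 + ?X" .
  have "(\<Sum>a\<in>C. 2 * (?c - 1)) \<le> (\<Sum>a\<in>C. \<Sum>b\<in>C. ?D a b)"
  proof (rule sum_mono)
    fix a assume a: "a \<in> C"
    have "2 * (?c - 1) = (\<Sum>b\<in>C - {a}. 2)" using a fin c
      by (simp add: card_Diff_singleton of_nat_diff Suc_leI card_gt_0_iff)
    also have "\<dots> \<le> (\<Sum>b\<in>C - {a}. ?D a b)"
      using a C by (intro sum_mono mass_edge) (auto simp: clique_def)
    also have "\<dots> \<le> (\<Sum>b\<in>C. ?D a b)"
      using fin by (intro sum_mono2 sum_nonneg mult_nonneg_nonneg neg_power_nonneg) auto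
    finally show "2 * (?c - 1) \<le> (\<Sum>b\<in>C. ?D a b)" .
  qed
  then have "?c * (?c - 1) + ?X \<le> ?c * energy C" using eq by (simp add: algebra_simps)
  then have "?c - 1 + ?X / ?c \<le> energy C" using c by (simp add: field_simps)
  then show ?thesis by (simp add: sum_divide_distrib)
qed

lemma energy_clique:
  assumes "C \<subseteq> V" "clique C"
  shows "energy C \<ge> real (card C) - 1"
proof (cases "C = {}")
  case False
  have "(\<Sum>j\<in>J. neg_power p (lam j) * ((\<Sum>v\<in>C. e j v)\<^sup>2 / real (card C))) \<ge> 0"
    by (intro sum_nonneg mult_nonneg_nonneg neg_power_nonneg) auto
  then show ?thesis using energy_clique_surplus[OF assms False] by linarith
qed (simp add: energy_def)

text \<open>
  Suppose that a set of vertices splits into cliques \<open>C i\<close> between which all or no edges are present,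
  according to the graph \<open>R\<close> on the indices. A vector \<open>z\<close> showing that \<open>R\<close> has an eigenvalue at
  most \<open>- s\<close>, with \<open>s \<ge> 1\<close>, is spread evenly over the classes. Its quotient of \<open>\<langle>u, A u\<rangle>\<close> by
  \<open>\<bar>u\<bar>\<^sup>2\<close> is still at most \<open>- s\<close>: with \<open>c i\<close> the size of \<open>C i\<close>, the sum
  \<open>\<langle>u, A u\<rangle> + s \<bar>u\<bar>\<^sup>2\<close> changes by \<open>- (s - 1) (\<Sum>i. (z i)\<^sup>2 (1 - 1 / c i))\<close>. Being constant on the
  classes, the spread vector is orthogonal to all differences inside them, so by Cauchy-Schwarz its
  contribution \<open>s\<^sup>p\<close> is paid for by the surpluses of the cliques.
\<close>
lemma energy_blow_up:
  fixes C :: "'i \<Rightarrow> 'a set" and z :: "'i \<Rightarrow> real" and R :: "'i \<Rightarrow> 'i \<Rightarrow> bool"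
  assumes I: "finite I"
    and C: "\<And>i. i \<in> I \<Longrightarrow> C i \<subseteq> V" "\<And>i. i \<in> I \<Longrightarrow> C i \<noteq> {}" "\<And>i. i \<in> I \<Longrightarrow> clique (C i)"
    and disj: "\<And>i k. i \<in> I \<Longrightarrow> k \<in> I \<Longrightarrow> i \<noteq> k \<Longrightarrow> C i \<inter> C k = {}"
    and hom: "\<And>i k a b. i \<in> I \<Longrightarrow> k \<in> I \<Longrightarrow> i \<noteq> k \<Longrightarrow> a \<in> C i \<Longrightarrow> b \<in> C k \<Longrightarrow> adj a b \<longleftrightarrow> R i k"
    and form: "(\<Sum>i\<in>I. \<Sum>k\<in>I. if i \<noteq> k \<and> R i k then z i * z k else 0) \<le> - s * (\<Sum>i\<in>I. (z i)\<^sup>2)"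
    and s: "s \<ge> 1" and z: "(\<Sum>i\<in>I. (z i)\<^sup>2) > 0"
  shows "energy (\<Union>i\<in>I. C i) \<ge> (\<Sum>i\<in>I. real (card (C i)) - 1) + s powr p"
proof -
  have finC: "finite (C i)" if "i \<in> I" for i using C(1)[OF that] finite_V finite_subset by blast
  define c where "c i = real (card (C i))" for i
  have c1: "c i \<ge> 1" if "i \<in> I" for i
    using finC[OF that] C(2)[OF that] by (simp add: c_def Suc_leI card_gt_0_iff)
  define u where "u v = (\<Sum>i\<in>I. z i / c i * of_bool (v \<in> C i))" for v
  have inner: "(\<Sum>v\<in>V. u v * g v) = (\<Sum>i\<in>I. z i / c i * (\<Sum>v\<in>C i. g v))" for g
  proof -
    have "(\<Sum>v\<in>V. u v * g v) = (\<Sum>v\<in>V. \<Sum>i\<in>I. z i / c i * (of_bool (v \<in> C i) * g v))"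
      unfolding u_def by (simp only: sum_distrib_right mult.assoc)
    also have "\<dots> = (\<Sum>i\<in>I. \<Sum>v\<in>V. z i / c i * (of_bool (v \<in> C i) * g v))"
      by (rule sum.swap)
    also have "\<dots> = (\<Sum>i\<in>I. z i / c i * (\<Sum>v\<in>V. of_bool (v \<in> C i) * g v))"
      by (simp only: sum_distrib_left)
    also have "\<dots> = (\<Sum>i\<in>I. z i / c i * (\<Sum>v\<in>C i. g v))"
    proof (rule sum.cong)
      fix i assume "i \<in> I"
      then have "(\<Sum>v\<in>V. of_bool (v \<in> C i) * g v) = (\<Sum>v\<in>C i. g v)"
        using finite_V C(1) by (intro sum.mono_neutral_cong_right) auto
      then show "z i / c i * (\<Sum>v\<in>V. of_bool (v \<in> C i) * g v) = z i / c i * (\<Sum>v\<in>C i. g v)"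
        by simp
    qed simp
    finally show ?thesis .
  qed
  have u_on: "u v = z i / c i" if "i \<in> I" "v \<in> C i" for i v
  proof -
    have "v \<in> C k \<longleftrightarrow> k = i" if "k \<in> I" for k
      using disj[of i k] \<open>i \<in> I\<close> \<open>v \<in> C i\<close> that by auto
    then have "u v = (\<Sum>k\<in>I. if k = i then z i / c i else 0)"
      unfolding u_def by (intro sum.cong) simp_all
    then show ?thesis using I that by simp
  qed
  define N where "N = (\<Sum>i\<in>I. (z i)\<^sup>2 / c i)"
  have norm: "(\<Sum>v\<in>V. (u v)\<^sup>2) = N"
  proof -
    have "(\<Sum>v\<in>V. (u v)\<^sup>2) = (\<Sum>i\<in>I. z i / c i * (\<Sum>v\<in>C i. u v))"
      unfolding power2_eq_square by (rule inner)
    also have "\<dots> = N" unfolding N_def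
    proof (rule sum.cong)
      fix i assume i: "i \<in> I"
      then have "(\<Sum>v\<in>C i. u v) = c i * (z i / c i)" by (simp add: u_on c_def)
      then show "z i / c i * (\<Sum>v\<in>C i. u v) = (z i)\<^sup>2 / c i"
        using c1[OF i] by (simp add: power2_eq_square)
    qed simp
    finally show ?thesis .
  qed
  have N_pos: "N > 0"
  proof -
    obtain i where i: "i \<in> I" "z i \<noteq> 0" 
    proof (rule ccontr)
      assume "\<not> thesis"
      then have "\<And>i. i \<in> I \<Longrightarrow> z i = 0" using that by blast
      then show False using z by simp
    qed
    show ?thesis unfolding N_def
      by (rule sum_pos2[of _ i]) (use I i c1[OF i(1)] in \<open>auto simp: c_def\<close>)
  qed
  let ?q = "\<Sum>i\<in>I. \<Sum>k\<in>I. if i \<noteq> k \<and> R i k then z i * z k else 0"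
  \<comment> \<open>The contribution of a pair of classes to the form, up to the factor of the first class.\<close>
  have e: "(\<Sum>a\<in>C i. z k / c k * (\<Sum>b\<in>C k. of_bool (adj a b)))
      = (if i = k then z i * (1 - 1 / c i) * c i else if R i k then c i * z k else 0)"
    if ik: "i \<in> I" "k \<in> I" for i k
  proof (cases "i = k")
    case True
    have "(\<Sum>b\<in>C i. of_bool (adj a b)) = c i - 1" if a: "a \<in> C i" for a
    proof -
      have "(\<Sum>b\<in>C i. of_bool (adj a b)) = (\<Sum>b\<in>C i - {a}. 1 :: real)"
        using finC[OF ik(1)] C(3)[OF ik(1)] a adj_irrefl
        by (intro sum.mono_neutral_cong_right) (auto simp: clique_def)
      also have "\<dots> = c i - 1"
        using finC[OF ik(1)] a c1[OF ik(1)] by (simp add: c_def card_Diff_singleton of_nat_diff)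
      finally show ?thesis .
    qed
    then have "(\<Sum>a\<in>C i. z k / c k * (\<Sum>b\<in>C k. of_bool (adj a b))) = (\<Sum>a\<in>C i. z i / c i * (c i - 1))"
      using True by (intro sum.cong) auto
    then show ?thesis using True c1[OF ik(1)] by (simp add: c_def[symmetric] field_simps)
  next
    case False
    have "(\<Sum>b\<in>C k. of_bool (adj a b)) = (if R i k then c k else 0)" if "a \<in> C i" for a
      using hom[OF ik False that] by (simp add: c_def)
    then have "(\<Sum>a\<in>C i. z k / c k * (\<Sum>b\<in>C k. of_bool (adj a b)))
        = (\<Sum>a\<in>C i. z k / c k * (if R i k then c k else 0))"
      by (intro sum.cong) auto
    then show ?thesis using False c1[OF ik(2)] by (simp add: c_def[symmetric])
  qed
  have "(\<Sum>v\<in>V. \<Sum>w\<in>V. of_bool (adj v w) * u v * u w) = (\<Sum>v\<in>V. u v * (\<Sum>w\<in>V. u w * of_bool (adj v w)))"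
    by (simp add: sum_distrib_left mult_ac)
  also have "\<dots> = (\<Sum>i\<in>I. \<Sum>k\<in>I. z i / c i * (\<Sum>a\<in>C i. z k / c k * (\<Sum>b\<in>C k. of_bool (adj a b))))"
    unfolding inner by (subst sum.swap[of _ I]) (simp only: sum_distrib_left[of _ _ I])
  also have "\<dots> = (\<Sum>i\<in>I. \<Sum>k\<in>I. (if i \<noteq> k \<and> R i k then z i * z k else 0)
      + (if k = i then (z i)\<^sup>2 * (1 - 1 / c i) else 0))"
  proof (intro sum.cong refl)
    fix i k assume ik: "i \<in> I" "k \<in> I"
    show "z i / c i * (\<Sum>a\<in>C i. z k / c k * (\<Sum>b\<in>C k. of_bool (adj a b)))
      = (if i \<noteq> k \<and> R i k then z i * z k else 0) + (if k = i then (z i)\<^sup>2 * (1 - 1 / c i) else 0)"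
      unfolding e[OF ik] using c1[OF ik(1)] by (auto simp: power2_eq_square)
  qed
  also have "\<dots> = ?q + (\<Sum>i\<in>I. (z i)\<^sup>2) - N"
    using I by (simp add: sum.distrib N_def right_diff_distrib sum_subtractf)
  also have "\<dots> \<le> - s * N"
  proof -
    have "N \<le> (\<Sum>i\<in>I. (z i)\<^sup>2)" unfolding N_def
    proof (rule sum_mono)
      fix i assume "i \<in> I"
      then show "(z i)\<^sup>2 / c i \<le> (z i)\<^sup>2"
        using c1[of i] mult_left_mono[of 1 "c i" "(z i)\<^sup>2"] by (simp add: divide_le_eq)
    qed
    then have "(s - 1) * N \<le> (s - 1) * (\<Sum>i\<in>I. (z i)\<^sup>2)" using s by (intro mult_left_mono) auto
    then show ?thesis using form by (simp add: algebra_simps)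
  qed
  finally have mass_u: "mass u \<ge> s powr p * N"
    using mass_ge[of s u] s norm by simp
  define Y where "Y j i = (\<Sum>v\<in>C i. e j v)" for j i
  have "mass u / N \<le> (\<Sum>j\<in>J. neg_power p (lam j) * (\<Sum>i\<in>I. (Y j i)\<^sup>2 / c i))"
    unfolding mass_def inner sum_divide_distrib Y_def[symmetric]
  proof (rule sum_mono)
    fix j
    have "(\<Sum>i\<in>I. z i / c i * Y j i) = (\<Sum>i\<in>I. (z i / sqrt (c i)) * (Y j i / sqrt (c i)))"
      using c1 by (intro sum.cong) (auto simp: c_def)
    then have "(\<Sum>i\<in>I. z i / c i * Y j i)\<^sup>2
        \<le> (\<Sum>i\<in>I. (z i / sqrt (c i))\<^sup>2) * (\<Sum>i\<in>I. (Y j i / sqrt (c i))\<^sup>2)"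
      using Cauchy_Schwarz_ineq_sum[of "\<lambda>i. z i / sqrt (c i)" "\<lambda>i. Y j i / sqrt (c i)" I] by simp
    also have "\<dots> = N * (\<Sum>i\<in>I. (Y j i)\<^sup>2 / c i)"
      by (simp add: N_def power_divide c_def)
    finally have "(\<Sum>i\<in>I. z i / c i * Y j i)\<^sup>2 / N \<le> (\<Sum>i\<in>I. (Y j i)\<^sup>2 / c i)"
      using N_pos by (simp add: divide_le_eq mult.commute)
    then show "neg_power p (lam j) * (\<Sum>i\<in>I. z i / c i * Y j i)\<^sup>2 / N
        \<le> neg_power p (lam j) * (\<Sum>i\<in>I. (Y j i)\<^sup>2 / c i)"
      using mult_left_mono[OF _ neg_power_nonneg[of p "lam j"]] unfolding times_divide_eq_right[symmetric] by blast
  qed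
  also have "\<dots> = (\<Sum>i\<in>I. \<Sum>j\<in>J. neg_power p (lam j) * ((Y j i)\<^sup>2 / c i))"
    unfolding sum_distrib_left by (rule sum.swap)
  finally have "s powr p \<le> (\<Sum>i\<in>I. \<Sum>j\<in>J. neg_power p (lam j) * ((Y j i)\<^sup>2 / c i))"
    using mass_u N_pos pos_le_divide_eq[of N "s powr p" "mass u"] by linarith
  moreover have "(\<Sum>i\<in>I. c i - 1 + (\<Sum>j\<in>J. neg_power p (lam j) * ((Y j i)\<^sup>2 / c i))) \<le> (\<Sum>i\<in>I. energy (C i))"
    unfolding Y_def c_def by (intro sum_mono energy_clique_surplus C)
  moreover have "energy (\<Union>i\<in>I. C i) = (\<Sum>i\<in>I. energy (C i))"
    using I C(1) disj by (rule energy_UN)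
  ultimately show ?thesis by (simp add: sum.distrib c_def)
qed

section \<open>Blown-up stars, paths and windmills\<close>

lemma clique_Un_adj:
  assumes "clique (S \<union> T)" "S \<inter> T = {}" "a \<in> S" "b \<in> T"
  shows "adj a b" "adj b a"
proof -
  have "a \<noteq> b" using assms(2,3,4) by auto
  then show "adj a b" "adj b a" using assms(1,3,4) by (simp_all add: clique_def)
qed

text \<open>
  Blown-up stars \<open>K\<^sub>1\<^sub>,\<^sub>m\<close>: the vector with \<open>\<surd>m\<close> at the centre and \<open>- 1\<close> at the leaves
  belongs to the eigenvalue \<open>- \<surd>m\<close>, and \<open>(\<surd>m)\<^sup>p \<ge> m\<^sup>2\<close> because \<open>p \<ge> 4\<close>.
\<close>
lemma energy_star:
  fixes L :: "'i \<Rightarrow> 'a set"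
  assumes I: "finite I" "I \<noteq> {}"
    and K: "K \<subseteq> V" "K \<noteq> {}"
    and L: "\<And>i. i \<in> I \<Longrightarrow> L i \<subseteq> V" "\<And>i. i \<in> I \<Longrightarrow> L i \<noteq> {}"
    and KL: "\<And>i. i \<in> I \<Longrightarrow> clique (K \<union> L i)" "\<And>i. i \<in> I \<Longrightarrow> K \<inter> L i = {}"
    and LL: "\<And>i k. i \<in> I \<Longrightarrow> k \<in> I \<Longrightarrow> i \<noteq> k \<Longrightarrow> L i \<inter> L k = {}"
      "\<And>i k a b. i \<in> I \<Longrightarrow> k \<in> I \<Longrightarrow> i \<noteq> k \<Longrightarrow> a \<in> L i \<Longrightarrow> b \<in> L k \<Longrightarrow> \<not> adj a b"
  shows "energy (K \<union> (\<Union>i\<in>I. L i))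
    \<ge> real (card K) - 1 + (\<Sum>i\<in>I. real (card (L i)) - 1) + (real (card I))\<^sup>2"
proof -
  let ?m = "real (card I)"
  have m: "?m \<ge> 1" using I by (simp add: Suc_leI card_gt_0_iff)
  \<comment> \<open>The index \<open>None\<close> stands for the centre.\<close>
  define C where "C = case_option K L"
  define z where "z = case_option (sqrt ?m) (\<lambda>_ :: 'i. - 1)"
  define R where "R i k = (i = None \<or> k = None)" for i k :: "'i option"
  define I' where "I' = insert None (Some ` I)"
  have sum_I': "(\<Sum>i\<in>I'. f i) = f None + (\<Sum>i\<in>I. f (Some i))" for f :: "'i option \<Rightarrow> real"
    unfolding I'_def using I(1) by (simp add: sum.reindex)
  have norm: "(\<Sum>i\<in>I'. (z i)\<^sup>2) = 2 * ?m" unfolding sum_I' by (simp add: z_def)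
  have UN: "(\<Union>i\<in>I'. C i) = K \<union> (\<Union>i\<in>I. L i)" by (auto simp: C_def I'_def)
  have "(\<Sum>i\<in>I'. real (card (C i)) - 1) + sqrt ?m powr p \<le> energy (\<Union>i\<in>I'. C i)"
  proof (rule energy_blow_up[where z = z and R = R])
    show "finite I'" using I by (simp add: I'_def)
    show "C i \<subseteq> V" if "i \<in> I'" for i
      using that K(1) L(1) by (cases i) (simp_all add: I'_def C_def image_iff)
    show "C i \<noteq> {}" if "i \<in> I'" for i
      using that K(2) L(2) by (cases i) (simp_all add: I'_def C_def image_iff)
    show "clique (C i)" if "i \<in> I'" for i
    proof (cases i)
      case None
      obtain l where "l \<in> I" using I(2) by blast
      then show ?thesis using KL(1) None clique_subset by (simp add: C_def) blast
    next
      case (Some l)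
      then have "l \<in> I" using that by (auto simp: I'_def)
      then show ?thesis using KL(1) Some clique_subset by (simp add: C_def) blast
    qed
    show "C i \<inter> C k = {}" if "i \<in> I'" "k \<in> I'" "i \<noteq> k" for i k
      using that KL(2) LL(1)
      by (cases i; cases k) (simp_all add: I'_def C_def image_iff Int_commute[of _ K])
    show "adj a b = R i k" if "i \<in> I'" "k \<in> I'" "i \<noteq> k" "a \<in> C i" "b \<in> C k" for i k a b
    proof -
      note edge = clique_Un_adj[OF KL]
      show ?thesis
        using that LL(2)
        by (cases i; cases k) (simp_all add: I'_def C_def R_def image_iff edge)
    qed
    show "(\<Sum>i\<in>I'. \<Sum>k\<in>I'. if i \<noteq> k \<and> R i k then z i * z k else 0) \<le> - sqrt ?m * (\<Sum>i\<in>I'. (z i)\<^sup>2)"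
      unfolding norm unfolding sum_I' by (simp add: z_def R_def)
    show "sqrt ?m \<ge> 1" using m by simp
    show "(\<Sum>i\<in>I'. (z i)\<^sup>2) > 0" unfolding norm using m by simp
  qed
  moreover have "?m\<^sup>2 \<le> sqrt ?m powr p"
  proof -
    have "sqrt ?m ^ 4 = ((sqrt ?m)\<^sup>2)\<^sup>2" by (simp only: power_mult[symmetric]) simp
    then have "?m\<^sup>2 = sqrt ?m ^ 4" by simp
    also have "\<dots> = sqrt ?m powr 4" using m by (simp add: powr_numeral)
    also have "\<dots> \<le> sqrt ?m powr p" using p4 m by (intro powr_mono) auto
    finally show ?thesis .
  qed
  ultimately show ?thesis unfolding UN unfolding sum_I' by (simp add: C_def)
qed

text \<open>
  Blown-up paths on four vertices: the least eigenvalue of the path is about \<open>- 1.618\<close>, and the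
  integer vector \<open>(2, - 3, 3, - 2)\<close> already gives \<open>- 42 / 26 = - 21 / 13\<close>, whose fourth power exceeds
  \<open>6\<close>. The bound is thus the number of vertices minus \<open>4\<close> plus \<open>6\<close>.
\<close>
lemma energy_path4:
  assumes V: "A \<subseteq> V" "B \<subseteq> V" "C \<subseteq> V" "D \<subseteq> V"
    and ne: "A \<noteq> {}" "B \<noteq> {}" "C \<noteq> {}" "D \<noteq> {}"
    and cl: "clique (A \<union> B)" "clique (B \<union> C)" "clique (C \<union> D)"
    and disj: "A \<inter> B = {}" "A \<inter> C = {}" "A \<inter> D = {}" "B \<inter> C = {}" "B \<inter> D = {}" "C \<inter> D = {}"
    and non: "\<And>a c. a \<in> A \<Longrightarrow> c \<in> C \<Longrightarrow> \<not> adj a c" "\<And>a d. a \<in> A \<Longrightarrow> d \<in> D \<Longrightarrow> \<not> adj a d"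
      "\<And>b d. b \<in> B \<Longrightarrow> d \<in> D \<Longrightarrow> \<not> adj b d"
  shows "energy (A \<union> B \<union> C \<union> D) \<ge> real (card A) + real (card B) + real (card C) + real (card D) + 2"
proof -
  define I where "I = {0, 1, 2, 3 :: nat}"
  define F where "F = (!) [A, B, C, D]"
  define z where "z = (!) [2, -3, 3, -2 :: real]"
  define R where "R i k = (k = i + 1 \<or> i = k + 1)" for i k :: nat
  have disj': "B \<inter> A = {}" "C \<inter> A = {}" "D \<inter> A = {}" "C \<inter> B = {}" "D \<inter> B = {}" "D \<inter> C = {}"
    using disj by blast+
  have "(\<Sum>i\<in>I. real (card (F i)) - 1) + (21 / 13) powr p \<le> energy (\<Union>i\<in>I. F i)"
  proof (rule energy_blow_up[where z = z and R = R])
    show "F i \<inter> F k = {}" if "i \<in> I" "k \<in> I" "i \<noteq> k" for i k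
      using that unfolding I_def by (elim insertE emptyE) (simp_all add: F_def disj disj')
    show "adj a b = R i k" if "i \<in> I" "k \<in> I" "i \<noteq> k" "a \<in> F i" "b \<in> F k" for i k a b
    proof -
      have non': "\<not> adj c a" if "a \<in> A" "c \<in> C" for a c using non(1)[OF that] adj_sym by blast
      have non'': "\<not> adj d a" if "a \<in> A" "d \<in> D" for a d using non(2)[OF that] adj_sym by blast
      have non''': "\<not> adj d b" if "b \<in> B" "d \<in> D" for b d using non(3)[OF that] adj_sym by blast
      note edges = clique_Un_adj[OF cl(1) disj(1)] clique_Un_adj[OF cl(2) disj(4)] clique_Un_adj[OF cl(3) disj(6)]
      show ?thesis using that(1,2,4,5) that(3)
        unfolding I_def by (elim insertE emptyE) (simp_all add: F_def R_def edges non non' non'' non''')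
    qed
    show "clique (F i)" if "i \<in> I" for i
      using that clique_subset[OF cl(1)] clique_subset[OF cl(2)] clique_subset[OF cl(3)]
      unfolding I_def by (elim insertE emptyE) (simp_all add: F_def)
    show "F i \<subseteq> V" if "i \<in> I" for i
      using that V unfolding I_def by (elim insertE emptyE) (simp_all add: F_def)
    show "F i \<noteq> {}" if "i \<in> I" for i
      using that ne unfolding I_def by (elim insertE emptyE) (simp_all add: F_def)
  qed (simp_all add: I_def z_def R_def)
  moreover have "6 \<le> (21 / 13) powr p"
  proof -
    have "(6 :: real) \<le> (21 / 13) ^ 4" by (simp add: power_divide)
    also have "\<dots> = (21 / 13) powr 4" by (simp add: powr_numeral)
    also have "\<dots> \<le> (21 / 13) powr p" using p4 by (intro powr_mono) auto
    finally show ?thesis .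
  qed
  moreover have "(\<Union>i\<in>I. F i) = A \<union> B \<union> C \<union> D" by (auto simp: I_def F_def)
  ultimately show ?thesis by (simp add: I_def F_def)
qed

text \<open>
  The excess of \<open>1\<close> over the number of vertices is what pays for a clique elsewhere. Split each clique \<open>D\<close> into the neighbours \<open>A D\<close> of \<open>x\<close> and the rest \<open>B D\<close>. The sets
  \<open>A D\<close> are the leaves of a blown-up star with centre \<open>x\<close>, and each non-empty \<open>B D\<close> is a further
  clique, costing \<open>1\<close>. With \<open>m\<close> cliques the excess is at least \<open>m\<^sup>2 - 2 m - 1\<close>, and \<open>m\<^sup>2 - m - 1\<close> if
  all \<open>B D\<close> are empty, which suffices except in two cases. For \<open>m = 1\<close> the star with centre class
  \<open>A D\<close> and leaf classes \<open>{x}\<close> and \<open>B D\<close> is used; for \<open>m = 2\<close> with a non-empty \<open>B D\<close>, a blown-up path on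
  four vertices runs through \<open>x\<close>.
\<close>
lemma energy_windmill:
  assumes x: "x \<in> V" and fin: "finite \<D>"
    and D: "\<And>D. D \<in> \<D> \<Longrightarrow> D \<subseteq> V" "\<And>D. D \<in> \<D> \<Longrightarrow> clique D" "\<And>D. D \<in> \<D> \<Longrightarrow> x \<notin> D"
      "\<And>D. D \<in> \<D> \<Longrightarrow> \<exists>d\<in>D. adj x d"
    and disj: "\<And>D E. D \<in> \<D> \<Longrightarrow> E \<in> \<D> \<Longrightarrow> D \<noteq> E \<Longrightarrow> D \<inter> E = {}"
    and non: "\<And>D E d f. D \<in> \<D> \<Longrightarrow> E \<in> \<D> \<Longrightarrow> D \<noteq> E \<Longrightarrow> d \<in> D \<Longrightarrow> f \<in> E \<Longrightarrow> \<not> adj d f"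
    and ncl: "\<not> clique (insert x (\<Union>\<D>))"
  shows "energy (insert x (\<Union>\<D>)) \<ge> real (card (insert x (\<Union>\<D>))) + 1"
proof -
  define A where "A D = {d \<in> D. adj x d}" for D
  define B where "B D = D - A D" for D
  have finD: "finite D" if "D \<in> \<D>" for D using D(1)[OF that] finite_V finite_subset by blast
  have DAB: "D = A D \<union> B D" "A D \<inter> B D = {}" "A D \<subseteq> D" "B D \<subseteq> D" for D
    by (auto simp: A_def B_def)
  have cardD: "real (card D) = real (card (A D)) + real (card (B D))" if "D \<in> \<D>" for D
    using finD[OF that] DAB[of D] by (metis card_Un_disjoint finite_Un of_nat_add)
  have A: "A D \<noteq> {}" if "D \<in> \<D>" for D using D(4)[OF that] by (auto simp: A_def)
  have xA: "clique ({x} \<union> A D)" if "D \<in> \<D>" for D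
    using D(2)[OF that] adj_sym unfolding clique_def A_def by blast
  have "card (insert x (\<Union>\<D>)) = Suc (\<Sum>D\<in>\<D>. card D)"
  proof -
    have "card (\<Union>\<D>) = (\<Sum>D\<in>\<D>. card D)"
      by (rule card_Union_disjoint) (use disj finD in \<open>simp_all add: pairwise_def disjnt_def\<close>)
    moreover have "x \<notin> \<Union>\<D>" using D(3) by blast
    moreover have "finite (\<Union>\<D>)" using fin finD by blast
    ultimately show ?thesis by simp
  qed
  then have cardT: "real (card (insert x (\<Union>\<D>))) = 1 + (\<Sum>D\<in>\<D>. real (card D))" by simp
  have star: "energy (insert x (\<Union>\<D>)) \<ge> (\<Sum>D\<in>\<D>. real (card D)) - real (card \<D>)
      - real (card {D\<in>\<D>. B D \<noteq> {}}) + (real (card \<D>))\<^sup>2" if ne: "\<D> \<noteq> {}"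
  proof -
    have "energy ({x} \<union> (\<Union>D\<in>\<D>. A D)) \<ge> real (card {x}) - 1 + (\<Sum>D\<in>\<D>. real (card (A D)) - 1) + (real (card \<D>))\<^sup>2"
    proof (rule energy_star)
      show "A D \<subseteq> V" if "D \<in> \<D>" for D using D(1)[OF that] DAB(3)[of D] by blast
      show "{x} \<inter> A D = {}" if "D \<in> \<D>" for D using D(3)[OF that] DAB(3)[of D] by blast
      show "A D \<inter> A E = {}" if "D \<in> \<D>" "E \<in> \<D>" "D \<noteq> E" for D E
        using disj[OF that] DAB(3)[of D] DAB(3)[of E] by blast
      show "\<not> adj a b" if "D \<in> \<D>" "E \<in> \<D>" "D \<noteq> E" "a \<in> A D" "b \<in> A E" for D E a b
        using non[OF that(1,2,3)] that(4,5) DAB(3)[of D] DAB(3)[of E] by blast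
    qed (use fin ne x A xA in simp_all)
    moreover have "energy (\<Union>D\<in>\<D>. B D) = (\<Sum>D\<in>\<D>. energy (B D))"
    proof (rule energy_UN)
      show "B D \<subseteq> V" if "D \<in> \<D>" for D using D(1)[OF that] DAB(4)[of D] by blast
      show "B D \<inter> B E = {}" if "D \<in> \<D>" "E \<in> \<D>" "D \<noteq> E" for D E
        using disj[OF that] DAB(4)[of D] DAB(4)[of E] by blast
    qed (rule fin)
    moreover have "(\<Sum>D\<in>\<D>. real (card (B D)) - of_bool (B D \<noteq> {})) \<le> (\<Sum>D\<in>\<D>. energy (B D))"
    proof (rule sum_mono)
      fix D assume DD: "D \<in> \<D>"
      have "energy (B D) \<ge> real (card (B D)) - 1"
        using D(1)[OF DD] clique_subset[OF D(2)[OF DD] DAB(4)] DAB(4)[of D] by (intro energy_clique) auto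
      then show "real (card (B D)) - of_bool (B D \<noteq> {}) \<le> energy (B D)"
        using energy_nonneg[of "B D"] by (cases "B D = {}") auto
    qed
    moreover have "(\<Sum>D\<in>\<D>. of_bool (B D \<noteq> {}) :: real) = real (card {D\<in>\<D>. B D \<noteq> {}})"
      using fin by (simp add: Int_def)
    moreover have "energy (insert x (\<Union>\<D>)) = energy ({x} \<union> (\<Union>D\<in>\<D>. A D)) + energy (\<Union>D\<in>\<D>. B D)"
    proof -
      have "insert x (\<Union>\<D>) = ({x} \<union> (\<Union>D\<in>\<D>. A D)) \<union> (\<Union>D\<in>\<D>. B D)" by (auto simp: B_def A_def)
      moreover have "({x} \<union> (\<Union>D\<in>\<D>. A D)) \<inter> (\<Union>D\<in>\<D>. B D) = {}"
      proof -
        have "b \<notin> {x} \<union> (\<Union>D\<in>\<D>. A D)" if "D \<in> \<D>" "b \<in> B D" for D b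
        proof -
          have "b \<in> D" "b \<notin> A D" using that(2) by (auto simp: B_def)
          moreover have "b \<notin> A E" if "E \<in> \<D>" "E \<noteq> D" for E
            using disj[OF that(1) \<open>D \<in> \<D>\<close> that(2)] \<open>b \<in> D\<close> DAB(3)[of E] by blast
          ultimately show ?thesis using D(3)[OF that(1)] by blast
        qed
        then show ?thesis by blast
      qed
      moreover have "{x} \<union> (\<Union>D\<in>\<D>. A D) \<subseteq> V" "(\<Union>D\<in>\<D>. B D) \<subseteq> V"
        using x D(1) DAB(3,4) by blast+
      ultimately show ?thesis by (simp only: energy_Un)
    qed
    moreover have "(\<Sum>D\<in>\<D>. real (card D)) = (\<Sum>D\<in>\<D>. real (card (A D))) + (\<Sum>D\<in>\<D>. real (card (B D)))"
      using cardD by (simp add: sum.distrib)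
    ultimately show ?thesis by (simp add: sum_subtractf)
  qed
  have Bcard: "card {D\<in>\<D>. B D \<noteq> {}} \<le> card \<D>" using fin by (intro card_mono) auto
  consider (0) "card \<D> = 0" | (1) "card \<D> = 1" | (2) "card \<D> = 2" | (3) "card \<D> \<ge> 3" by linarith
  then show ?thesis
  proof cases
    case 0
    then have "\<D> = {}" using fin by simp
    then show ?thesis using ncl by (simp add: clique_def)
  next
    case 1
    then obtain D0 where D0: "\<D> = {D0}" by (auto simp: card_1_singleton_iff)
    have B: "B D0 \<noteq> {}"
      using ncl xA[of D0] DAB(1)[of D0] unfolding D0 by auto
    \<comment> \<open>The two leaf classes of the star centred at the neighbours of \<open>x\<close>, indexed by the booleans.\<close>
    define L where "L i = (if i then {x} else B D0)" for i
    have "energy (A D0 \<union> (\<Union>i\<in>UNIV. L i)) \<ge> real (card (A D0)) - 1 + (\<Sum>i\<in>UNIV. real (card (L i)) - 1) + (real (card (UNIV :: bool set)))\<^sup>2"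
    proof (rule energy_star)
      have nadj: "\<not> adj x b \<and> \<not> adj b x" if "b \<in> B D0" for b
        using that adj_sym by (auto simp: A_def B_def)
      have "clique (A D0 \<union> B D0)" using D(2)[of D0] DAB(1)[of D0] D0 by simp
      then show "clique (A D0 \<union> L i)" for i
        using xA[of D0] D0 by (simp add: L_def Un_commute)
      show "\<not> adj a b" if "i \<noteq> k" "a \<in> L i" "b \<in> L k" for i k a b
        using that nadj by (auto simp: L_def split: if_splits)
      show "L i \<inter> L k = {}" if "i \<noteq> k" for i k
        using that D(3)[of D0] DAB(4)[of D0] D0 by (auto simp: L_def)
      show "A D0 \<inter> L i = {}" for i
        using D(3)[of D0] DAB[of D0] D0 by (auto simp: L_def)
    qed (use A B x D(1) D0 DAB in \<open>auto simp: L_def\<close>)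
    moreover have "A D0 \<union> (\<Union>i\<in>UNIV. L i) = insert x (\<Union>\<D>)"
      using DAB(1)[of D0] D0 by (auto simp: L_def UNIV_bool)
    ultimately show ?thesis using cardT cardD[of D0] D0 by (simp add: UNIV_bool L_def)
  next
    case 3
    then have "\<D> \<noteq> {}" by auto
    have "real (card \<D>) * 3 \<le> (real (card \<D>))\<^sup>2"
      using 3 by (simp add: power2_eq_square mult_left_mono)
    then show ?thesis using star[OF \<open>\<D> \<noteq> {}\<close>] cardT Bcard 3 by linarith
  next
    case 2
    then have ne: "\<D> \<noteq> {}" by auto
    show ?thesis
    proof (cases "\<exists>D\<in>\<D>. B D \<noteq> {}")
      case False
      then have "{D\<in>\<D>. B D \<noteq> {}} = {}" by auto
      then have "real (card {D\<in>\<D>. B D \<noteq> {}}) = 0" by (simp only: card.empty of_nat_0)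
      moreover have "(real (card \<D>))\<^sup>2 = 4" "real (card \<D>) = 2" using 2 by simp_all
      ultimately show ?thesis using star[OF ne] cardT by linarith
    next
      case True
      then obtain D1 where D1: "D1 \<in> \<D>" "B D1 \<noteq> {}" by blast
      then obtain D2 where D2: "D2 \<in> \<D>" "D2 \<noteq> D1" "\<D> = {D1, D2}"
      proof -
        obtain D E where "\<D> = {D, E}" "D \<noteq> E" using 2 by (auto simp: card_2_iff)
        then show thesis using D1(1) that[of D] that[of E] by (cases "D1 = D") (simp_all add: insert_commute)
      qed
      have nadj: "\<not> adj b x" if "b \<in> B D1" for b
      proof
        assume "adj b x"
        then have "adj x b" by (rule adj_sym)
        then show False using that by (simp add: A_def B_def)
      qed
      have x12: "x \<notin> D1" "x \<notin> D2" using D(3) D1(1) D2(1) by blast+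
      have D12: "D1 \<inter> D2 = {}" using disj[OF D1(1) D2(1)] D2(2) by blast
      have n12: "\<not> adj a b" if "a \<in> D1" "b \<in> D2" for a b
        using non[OF D1(1) D2(1) D2(2)[symmetric] that] .
      note sub = DAB(3,4)[of D1] DAB(3,4)[of D2]
      have "energy (B D1 \<union> A D1 \<union> {x} \<union> A D2)
        \<ge> real (card (B D1)) + real (card (A D1)) + real (card {x}) + real (card (A D2)) + 2"
      proof (rule energy_path4)
        show "clique (B D1 \<union> A D1)" using D(2)[OF D1(1)] DAB(1)[of D1] by (simp add: Un_commute)
        show "clique (A D1 \<union> {x})" "clique ({x} \<union> A D2)" using xA D1 D2 by (simp_all add: Un_commute)
        show "B D1 \<subseteq> V" "A D1 \<subseteq> V" "{x} \<subseteq> V" "A D2 \<subseteq> V"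
          using x sub D(1)[OF D1(1)] D(1)[OF D2(1)] by auto
        show "B D1 \<noteq> {}" "A D1 \<noteq> {}" "{x} \<noteq> {}" "A D2 \<noteq> {}"
          using D1(2) A[OF D1(1)] A[OF D2(1)] by simp_all
        show "B D1 \<inter> A D1 = {}" using DAB(2)[of D1] by (simp only: Int_commute)
        show "B D1 \<inter> {x} = {}" "A D1 \<inter> {x} = {}" "{x} \<inter> A D2 = {}" using x12 sub by auto
        show "B D1 \<inter> A D2 = {}" "A D1 \<inter> A D2 = {}" using D12 sub by auto
        show "\<not> adj b y" if "b \<in> B D1" "y \<in> {x}" for b y using nadj that by simp
        show "\<not> adj b a" if "b \<in> B D1" "a \<in> A D2" for a b using n12 that sub by blast
        show "\<not> adj b a" if "b \<in> A D1" "a \<in> A D2" for a b using n12 that sub by blast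
      qed
      moreover have "energy (B D2) \<ge> real (card (B D2)) - 1"
        using D(1)[OF D2(1)] clique_subset[OF D(2)[OF D2(1)] DAB(4)] DAB(4)[of D2] by (intro energy_clique) auto
      moreover have "energy (insert x (\<Union>\<D>)) = energy (B D1 \<union> A D1 \<union> {x} \<union> A D2) + energy (B D2)"
      proof -
        have "insert x (\<Union>\<D>) = (B D1 \<union> A D1 \<union> {x} \<union> A D2) \<union> B D2"
          unfolding D2(3) by (auto simp: B_def A_def)
        moreover have "(B D1 \<union> A D1 \<union> {x} \<union> A D2) \<inter> B D2 = {}"
          using x12(2) D12 sub DAB(2)[of D2] by blast
        moreover have "B D1 \<union> A D1 \<union> {x} \<union> A D2 \<subseteq> V" "B D2 \<subseteq> V"
          using x D(1)[OF D1(1)] D(1)[OF D2(1)] DAB(3,4)[of D1] DAB(3,4)[of D2] by auto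
        ultimately show ?thesis by (simp only: energy_Un)
      qed
      ultimately show ?thesis
        using cardT cardD[OF D1(1)] cardD[OF D2(1)] D2 by simp
    qed
  qed
qed

section \<open>Connected sets\<close>

text \<open>
  Connectedness of the subgraph induced by \<open>S\<close>, expressed by cuts: this form makes it immediate that
  a connected set lies on one side of any partition without crossing edges.
\<close>
definition conn :: "'a set \<Rightarrow> bool" where
  "conn S \<longleftrightarrow> S \<noteq> {} \<and> (\<forall>A. A \<subseteq> S \<and> A \<noteq> {} \<and> A \<noteq> S \<longrightarrow> (\<exists>a\<in>A. \<exists>b\<in>S - A. adj a b))"

lemma conn_subset_side:
  assumes S: "conn S" "S \<subseteq> X" and A: "\<And>a b. a \<in> A \<Longrightarrow> b \<in> X - A \<Longrightarrow> \<not> adj a b" and meet: "S \<inter> A \<noteq> {}"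
  shows "S \<subseteq> A"
proof (rule ccontr)
  assume "\<not> S \<subseteq> A"
  then have "S \<inter> A \<subseteq> S" "S \<inter> A \<noteq> S" by auto
  then obtain a b where "a \<in> S \<inter> A" "b \<in> S - S \<inter> A" "adj a b"
    using S(1) meet unfolding conn_def by meson
  then show False using A[of a b] S(2) by auto
qed

lemma connI:
  assumes "S \<noteq> {}"
    and "\<And>A. A \<subseteq> S \<Longrightarrow> A \<noteq> {} \<Longrightarrow> (\<And>a b. a \<in> A \<Longrightarrow> b \<in> S - A \<Longrightarrow> \<not> adj a b) \<Longrightarrow> A = S"
  shows "conn S"
  unfolding conn_def using assms by meson

lemma conn_Union:
  assumes F: "F \<noteq> {}" "\<And>S. S \<in> F \<Longrightarrow> conn S" "\<And>S. S \<in> F \<Longrightarrow> x \<in> S"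
  shows "conn (\<Union>F)"
proof (rule connI)
  show "\<Union>F \<noteq> {}" using F(1,3) by blast
  fix A assume A: "A \<subseteq> \<Union>F" "A \<noteq> {}" and non: "\<And>a b. a \<in> A \<Longrightarrow> b \<in> \<Union>F - A \<Longrightarrow> \<not> adj a b"
  have side: "S \<subseteq> A" if "S \<in> F" "S \<inter> A \<noteq> {}" for S
    by (rule conn_subset_side[OF F(2)[OF that(1)] _ non that(2)]) (use that(1) in blast)+
  obtain a S where "a \<in> A" "a \<in> S" "S \<in> F" using A by blast
  then have "x \<in> A" using side[of S] F(3)[of S] by blast
  then have "S \<subseteq> A" if "S \<in> F" for S using side[OF that] F(3)[OF that] by blast
  then show "A = \<Union>F" using A(1) by blast
qed

lemma conn_Un:
  assumes S: "conn S" and T: "conn T" and st: "s \<in> S" "t \<in> T" "adj s t"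
  shows "conn (S \<union> T)"
proof (rule connI)
  show "S \<union> T \<noteq> {}" using st(1) by blast
  fix A assume A: "A \<subseteq> S \<union> T" "A \<noteq> {}" and non: "\<And>a b. a \<in> A \<Longrightarrow> b \<in> S \<union> T - A \<Longrightarrow> \<not> adj a b"
  have sideS: "S \<subseteq> A" if "S \<inter> A \<noteq> {}" 
  proof (rule conn_subset_side[OF S _ _ that])
    show "S \<subseteq> S \<union> T" by blast
    show "\<not> adj a b" if "a \<in> A" "b \<in> S \<union> T - A" for a b by (rule non[OF that])
  qed
  have sideT: "T \<subseteq> A" if "T \<inter> A \<noteq> {}" 
  proof (rule conn_subset_side[OF T _ _ that])
    show "T \<subseteq> S \<union> T" by blast
    show "\<not> adj a b" if "a \<in> A" "b \<in> S \<union> T - A" for a b by (rule non[OF that])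
  qed
  have "t \<in> A" if "s \<in> A" using non[OF that, of t] st(2,3) by blast
  moreover have "s \<in> A" if "t \<in> A" using non[OF that, of s] st(1) adj_sym[OF st(3)] by blast
  moreover have "S \<inter> A \<noteq> {} \<or> T \<inter> A \<noteq> {}" using A by blast
  ultimately have "S \<subseteq> A \<and> T \<subseteq> A" using sideS sideT st(1,2) by blast
  then show "A = S \<union> T" using A(1) by blast
qed

lemma conn_clique:
  assumes "clique S" "S \<noteq> {}"
  shows "conn S"
proof (rule connI)
  fix A assume A: "A \<subseteq> S" "A \<noteq> {}" and non: "\<And>a b. a \<in> A \<Longrightarrow> b \<in> S - A \<Longrightarrow> \<not> adj a b"
  show "A = S"
  proof (rule ccontr)
    assume "A \<noteq> S"
    then obtain a b where ab: "a \<in> A" "b \<in> S - A" using A by blast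
    then have "a \<in> S" "b \<in> S" "a \<noteq> b" using A(1) by auto
    then have "adj a b" using assms(1) unfolding clique_def by simp
    then show False using non[OF ab] by simp
  qed
qed (rule assms(2))

lemma conn_singleton: "conn {x}"
  by (rule conn_clique) (simp_all add: clique_def)

lemma conn_insert:
  assumes "conn S" "s \<in> S" "adj s x"
  shows "conn (insert x S)"
proof -
  have "conn (S \<union> {x})" by (rule conn_Un[OF assms(1) conn_singleton assms(2) _ assms(3)]) simp
  then show ?thesis by simp
qed

text \<open>
  As long as a part is disconnected, it is split along a cut without crossing edges.
\<close>
lemma components_exist:
  assumes "finite U"
  shows "\<exists>\<D>. \<Union>\<D> = U \<and> finite \<D> \<and> (\<forall>D\<in>\<D>. conn D) \<and>
    (\<forall>D\<in>\<D>. \<forall>E\<in>\<D>. D \<noteq> E \<longrightarrow> D \<inter> E = {} \<and> (\<forall>d\<in>D. \<forall>f\<in>E. \<not> adj d f))"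
    (is "\<exists>\<D>. ?P \<D> U")
  using assms
proof (induction U rule: finite_psubset_induct)
  case (psubset U)
  consider "U = {}" | "conn U" | "U \<noteq> {}" "\<not> conn U" by blast
  then show ?case
  proof cases
    case 1
    then show ?thesis by (intro exI[of _ "{}"]) simp
  next
    case 2
    then show ?thesis by (intro exI[of _ "{U}"]) simp
  next
    case 3
    then obtain A where A: "A \<subseteq> U" "A \<noteq> {}" "A \<noteq> U" and non: "\<And>a b. a \<in> A \<Longrightarrow> b \<in> U - A \<Longrightarrow> \<not> adj a b"
      unfolding conn_def by blast
    have "A \<subset> U" "U - A \<subset> U" using A by auto
    obtain \<D> where D: "?P \<D> A" using psubset.IH[OF \<open>A \<subset> U\<close>] by (rule exE)
    obtain \<E> where E: "?P \<E> (U - A)" using psubset.IH[OF \<open>U - A \<subset> U\<close>] by (rule exE)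
    note D' = conjunct1[OF D] conjunct1[OF conjunct2[OF D]] conjunct1[OF conjunct2[OF conjunct2[OF D]]]
    note E' = conjunct1[OF E] conjunct1[OF conjunct2[OF E]] conjunct1[OF conjunct2[OF conjunct2[OF E]]]
    have cross: "D \<inter> E = {} \<and> (\<forall>d\<in>D. \<forall>f\<in>E. \<not> adj d f \<and> \<not> adj f d)" if "D \<in> \<D>" "E \<in> \<E>" for D E
    proof -
      have sub: "D \<subseteq> A" "E \<subseteq> U - A" using D'(1) E'(1) that by blast+
      have "\<not> adj d f \<and> \<not> adj f d" if "d \<in> D" "f \<in> E" for d f
      proof -
        have "\<not> adj d f" using non[of d f] sub that by blast
        then show ?thesis using adj_sym[of f d] by blast
      qed
      then show ?thesis using sub by blast
    qed
    have "\<Union>(\<D> \<union> \<E>) = U" using D'(1) E'(1) A(1) by auto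
    moreover have "D \<inter> E = {} \<and> (\<forall>d\<in>D. \<forall>f\<in>E. \<not> adj d f)"
      if "D \<in> \<D> \<union> \<E>" "E \<in> \<D> \<union> \<E>" "D \<noteq> E" for D E
    proof -
      consider "D \<in> \<D>" "E \<in> \<D>" | "D \<in> \<E>" "E \<in> \<E>" | "D \<in> \<D>" "E \<in> \<E>" | "D \<in> \<E>" "E \<in> \<D>"
        using \<open>D \<in> \<D> \<union> \<E>\<close> \<open>E \<in> \<D> \<union> \<E>\<close> by blast
      then show ?thesis
      proof cases
        case 1
        then show ?thesis using conjunct2[OF conjunct2[OF conjunct2[OF D]]] \<open>D \<noteq> E\<close> by simp
      next
        case 2
        then show ?thesis using conjunct2[OF conjunct2[OF conjunct2[OF E]]] \<open>D \<noteq> E\<close> by simp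
      next
        case 3
        then show ?thesis using cross[OF 3] by simp
      next
        case 4
        then show ?thesis using cross[OF 4(2,1)] by (simp add: Int_commute)
      qed
    qed
    moreover have "finite (\<D> \<union> \<E>)" "\<forall>D\<in>\<D> \<union> \<E>. conn D" using D'(2,3) E'(2,3) by blast+
    ultimately show ?thesis by (intro exI[of _ "\<D> \<union> \<E>"] conjI ballI impI) blast+
  qed
qed

text \<open>
  Induction on the number of vertices. A clique costs only \<open>1\<close>, so choose a clique \<open>C\<close>, possibly
  empty, of maximal size among those whose complement \<open>T\<close> in \<open>X\<close> is connected and not complete, and a
  vertex \<open>x\<close> of \<open>T\<close> adjacent to \<open>C\<close> (any \<open>x\<close> if \<open>C\<close> is empty). Suppose that some component \<open>D\<close> of
  \<open>T - {x}\<close> is not complete. The rest \<open>R = X - D\<close> is connected, as \<open>C\<close> and the other components are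
  attached to \<open>x\<close>. It is not a clique, because it is larger than \<open>C\<close> and its complement \<open>D\<close> is connected
  and not complete; so the induction hypothesis applies to \<open>D\<close> and to \<open>R\<close>. Otherwise all components are cliques, and the excess of \<open>1\<close> of the windmill
  \<open>T\<close> makes up for the cost of \<open>C\<close>.
\<close>
theorem energy_connected_noncomplete:
  assumes "X \<subseteq> V" "conn X" "\<not> clique X"
  shows "energy X \<ge> real (card X)"
  using assms
proof (induction "card X" arbitrary: X rule: less_induct)
  case less
  note X = less.prems
  have finX: "finite X" using X(1) finite_V finite_subset by blast
  define Q where "Q C \<longleftrightarrow> C \<subseteq> X \<and> clique C \<and> conn (X - C) \<and> \<not> clique (X - C)" for C
  have Q0: "Q {}" using X by (simp add: Q_def clique_def)
  have "\<forall>C. Q C \<longrightarrow> card C < Suc (card X)"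
    using finX by (simp add: Q_def card_mono less_Suc_eq_le)
  from ex_has_greatest_nat[of Q, OF Q0 this]
  obtain C where C: "Q C" and maxC: "\<And>C'. Q C' \<Longrightarrow> card C' \<le> card C" by blast
  define T where "T = X - C"
  have CX: "C \<subseteq> X" "clique C" and T: "conn T" "\<not> clique T" using C by (simp_all add: Q_def T_def)
  have finC: "finite C" and finT: "finite T" using CX(1) finX finite_subset T_def by auto
  have XT: "X = C \<union> T" "C \<inter> T = {}" using CX(1) by (auto simp: T_def)
  obtain x where x: "x \<in> T" and xC: "C = {} \<or> (\<exists>c\<in>C. adj c x)"
  proof (cases "C = {}")
    case True
    then show thesis using that T(1) by (auto simp: conn_def)
  next
    case False
    have "C \<noteq> X" using T(1) by (auto simp: conn_def T_def)
    then obtain c y where "c \<in> C" "y \<in> X - C" "adj c y"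
      using X(2) CX(1) False unfolding conn_def by meson
    then show thesis using that[of y] by (auto simp: T_def)
  qed
  have connCx: "conn (insert x C)"
  proof (cases "C = {}")
    case True
    then show ?thesis using conn_singleton by simp
  next
    case False
    then obtain c where "c \<in> C" "adj c x" using xC by blast
    then show ?thesis using conn_insert[OF conn_clique[OF CX(2) False]] by simp
  qed
  have "finite (T - {x})" using finT by simp
  from components_exist[OF this] obtain \<D> where
    UD: "\<Union>\<D> = T - {x}" and finD: "finite \<D>" and all_conn: "\<forall>D\<in>\<D>. conn D"
    and all_sep: "\<forall>D\<in>\<D>. \<forall>E\<in>\<D>. D \<noteq> E \<longrightarrow> D \<inter> E = {} \<and> (\<forall>d\<in>D. \<forall>f\<in>E. \<not> adj d f)"
    by (elim exE conjE)
  have connD: "conn D" if "D \<in> \<D>" for D using bspec[OF all_conn that] .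
  have sep: "D \<inter> E = {} \<and> (\<forall>d\<in>D. \<forall>f\<in>E. \<not> adj d f)" if "D \<in> \<D>" "E \<in> \<D>" "D \<noteq> E" for D E
    using bspec[OF bspec[OF all_sep that(1)] that(2)] that(3) by simp
  have sepD: "D \<inter> E = {}" if "D \<in> \<D>" "E \<in> \<D>" "D \<noteq> E" for D E
    using sep[OF that] by (rule conjunct1)
  have nonD: "\<not> adj d f" if "D \<in> \<D>" "E \<in> \<D>" "D \<noteq> E" "d \<in> D" "f \<in> E" for D E d f
    using conjunct2[OF sep[OF that(1-3)]] that(4,5) by simp
  have DT: "D \<subseteq> T" "x \<notin> D" "D \<noteq> {}" if "D \<in> \<D>" for D
  proof -
    have "D \<subseteq> T - {x}" using UD that by blast
    then show "D \<subseteq> T" "x \<notin> D" by blast+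
    show "D \<noteq> {}" using connD[OF that] by (simp add: conn_def)
  qed
  \<comment> \<open>Since \<open>T\<close> is connected, an edge leaves \<open>D\<close>; it cannot end in another component.\<close>
  have xD: "\<exists>d\<in>D. adj x d" if D: "D \<in> \<D>" for D
  proof -
    have "D \<noteq> T" using DT(2)[OF D] x by blast
    then obtain d y where dy: "d \<in> D" "y \<in> T - D" "adj d y"
      using T(1) DT(1,3)[OF D] unfolding conn_def by meson
    have "y = x"
    proof (rule ccontr)
      assume "y \<noteq> x"
      then obtain E where "E \<in> \<D>" "y \<in> E" using dy(2) UD by blast
      then show False using nonD[OF D, of E d y] dy by blast
    qed
    then show ?thesis using dy adj_sym by blast
  qed
  show ?case
  proof (cases "\<exists>D\<in>\<D>. \<not> clique D")
    case True
    then obtain D where D: "D \<in> \<D>" "\<not> clique D" by blast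
    define R where "R = X - D"
    have DX: "D \<subseteq> X" using DT(1)[OF D(1)] XT by blast
    define U where "U = \<Union>(\<D> - {D})"
    have "y \<notin> U" if "y \<in> D" for y
    proof
      assume "y \<in> U"
      then obtain E where "E \<in> \<D>" "E \<noteq> D" "y \<in> E" by (auto simp: U_def)
      then show False using sepD[OF D(1), of E] that by blast
    qed
    moreover have "\<Union>\<D> = D \<union> U" using D(1) by (auto simp: U_def)
    ultimately have "T - D = insert x U" using UD x DT(2)[OF D(1)] by blast
    moreover have "R = C \<union> (T - D)" unfolding R_def using XT DT(1)[OF D(1)] by blast
    ultimately have "R = insert x C \<union> U" by simp
    then have Rx: "R = \<Union>(insert (insert x C) (insert x ` (\<D> - {D})))" by (auto simp: U_def)
    have connR: "conn R" unfolding Rx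
    proof (rule conn_Union)
      fix S assume "S \<in> insert (insert x C) (insert x ` (\<D> - {D}))"
      then consider "S = insert x C" | E where "E \<in> \<D>" "S = insert x E" by blast
      then show "conn S"
      proof cases
        case 1
        then show ?thesis using connCx by simp
      next
        case 2
        obtain d where "d \<in> E" "adj x d" using xD[OF 2(1)] by blast
        then show ?thesis using conn_insert[OF connD[OF 2(1)] _ adj_sym] 2(2) by simp
      qed
    qed auto
    have XR: "X = D \<union> R" "D \<inter> R = {}" using DX by (auto simp: R_def)
    have xR: "x \<in> R" "C \<subseteq> R" using XT x DT(1,2)[OF D(1)] by (auto simp: R_def)
    have "\<not> clique R"
    proof
      assume "clique R"
      moreover have "X - R = D" using XR by blast
      ultimately have "Q R" using D connD[OF D(1)] by (simp add: Q_def R_def)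
      moreover have "card C < card R"
      proof (rule psubset_card_mono)
        show "finite R" using finX by (simp add: R_def)
        show "C \<subset> R" using xR x XT(2) by blast
      qed
      ultimately show False using maxC[of R] by simp
    qed
    have "D \<subset> X" "R \<subset> X" using DX XR xR(1) DT(2,3)[OF D(1)] by auto
    then have "card D < card X" "card R < card X" using finX by (auto intro: psubset_card_mono)
    moreover have "D \<subseteq> V" "R \<subseteq> V" using \<open>D \<subset> X\<close> \<open>R \<subset> X\<close> X(1) by auto
    ultimately have "energy D \<ge> card D" "energy R \<ge> card R"
      using less.hyps[OF _ _ connD[OF D(1)] D(2)] less.hyps[OF _ _ connR \<open>\<not> clique R\<close>] by simp_all
    moreover have "energy X = energy D + energy R"
      using energy_Un[OF \<open>D \<subseteq> V\<close> \<open>R \<subseteq> V\<close> XR(2)] XR(1) by simp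
    moreover have "card X = card D + card R"
    proof -
      have "finite D" "finite R" using DX finX by (auto simp: R_def intro: finite_subset)
      then show ?thesis using card_Un_disjoint[OF _ _ XR(2)] XR(1) by simp
    qed
    ultimately show ?thesis by simp
  next
    case False
    have TD: "insert x (\<Union>\<D>) = T" using UD x by blast
    have "T \<subseteq> V" "C \<subseteq> V" using X(1) XT by auto
    have "energy (insert x (\<Union>\<D>)) \<ge> real (card (insert x (\<Union>\<D>))) + 1"
    proof (rule energy_windmill)
      show "x \<in> V" using x \<open>T \<subseteq> V\<close> by blast
      show "D \<subseteq> V" if "D \<in> \<D>" for D using DT(1)[OF that] \<open>T \<subseteq> V\<close> by blast
      show "clique D" if "D \<in> \<D>" for D using False that by blast
      show "\<not> clique (insert x (\<Union>\<D>))" unfolding TD by (rule T(2))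
    qed (fact finD DT(2) xD sepD nonD)+
    then have "energy T \<ge> real (card T) + 1" unfolding TD .
    moreover have "energy C \<ge> real (card C) - 1" using energy_clique[OF \<open>C \<subseteq> V\<close> CX(2)] .
    moreover have "energy X = energy C + energy T"
      using energy_Un[OF \<open>C \<subseteq> V\<close> \<open>T \<subseteq> V\<close> XT(2)] XT(1) by simp
    moreover have "card X = card C + card T"
      using XT finC finT by (simp add: card_Un_disjoint)
    ultimately show ?thesis by simp
  qed
qed

end

section \<open>From adjacency matrices to energies\<close>

lemma sum_of_scaled_squares:
  fixes U :: "'i \<Rightarrow> real" and l :: "'j \<Rightarrow> real"
  shows "(\<Sum>j\<in>J. l j * (\<Sum>i\<in>I. U i * P i j)\<^sup>2) = (\<Sum>i\<in>I. \<Sum>k\<in>I. U i * U k * (\<Sum>j\<in>J. l j * (P i j * P k j)))"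
proof -
  have "(\<Sum>j\<in>J. l j * (\<Sum>i\<in>I. U i * P i j)\<^sup>2) = (\<Sum>j\<in>J. \<Sum>i\<in>I. \<Sum>k\<in>I. U i * U k * (l j * (P i j * P k j)))"
    unfolding power2_eq_square sum_product sum_distrib_left
    by (intro sum.cong refl) (simp add: sum_distrib_left mult_ac)
  also have "\<dots> = (\<Sum>i\<in>I. \<Sum>j\<in>J. \<Sum>k\<in>I. U i * U k * (l j * (P i j * P k j)))"
    by (rule sum.swap)
  also have "\<dots> = (\<Sum>i\<in>I. \<Sum>k\<in>I. \<Sum>j\<in>J. U i * U k * (l j * (P i j * P k j)))"
    by (intro sum.cong refl sum.swap)
  finally show ?thesis by (simp only: sum_distrib_left)
qed

text \<open>
  The entrywise spectral theorem, carried over from positions in the enumeration to vertices. Since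
  each eigenvector has length \<open>1\<close>, summing the energy over all vertices recovers one term
  \<open>f(lam j)\<close> for each eigenvalue.
\<close>
lemma spectral_graph_of_adjacency_matrix:
  fixes G :: "'a pair_pre_digraph" and p :: real
  assumes p: "p \<ge> 4" and G: "pair_graph G" and vs: "distinct vs" "set vs = pverts G"
  obtains e :: "nat \<Rightarrow> 'a \<Rightarrow> real" and lam where
    "spectral_graph (pverts G) (\<lambda>a b. (a, b) \<in> parcs G) {..<length vs} e lam p"
    "spectral_graph.energy {..<length vs} e lam p (pverts G) = negative_energy p G vs"
proof -
  interpret G: pair_graph G by (rule G)
  define n where "n = length vs"
  define A where "A = adjacency_matrix G vs"
  have sym: "(b, a) \<in> parcs G" if "(a, b) \<in> parcs G" for a b
    using that G.pair_sym_arcs unfolding symmetric_def sym_def by simp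
  have A: "A \<in> carrier_mat n n" by (simp add: A_def adjacency_matrix_def n_def)
  have Aik: "A $$ (i, k) = of_bool ((vs ! i, vs ! k) \<in> parcs G)" if "i < n" "k < n" for i k
    using that by (simp add: A_def adjacency_matrix_def n_def)
  have symA: "transpose_mat A = A"
    by (rule eq_matI) (use A sym in \<open>auto simp: Aik\<close>)
  obtain P es where es: "length es = n"
    and cp: "char_poly A = (\<Prod>e\<leftarrow>es. [:- e, 1:])"
    and rows: "\<And>i k. i < n \<Longrightarrow> k < n \<Longrightarrow> (\<Sum>j<n. P i j * P k j) = (if i = k then 1 else 0 :: real)"
    and cols: "\<And>j. j < n \<Longrightarrow> (\<Sum>i<n. (P i j)\<^sup>2) = 1"
    and entries: "\<And>i k. i < n \<Longrightarrow> k < n \<Longrightarrow> A $$ (i, k) = (\<Sum>j<n. es ! j * (P i j * P k j))"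
    by (rule symmetric_spectral_sums[OF A symA], rule that)
  have bij: "bij_betw ((!) vs) {..<n} (pverts G)"
    using bij_betw_nth[OF vs(1), of "{..<n}" "pverts G"] vs(2) by (simp add: n_def)
  define e where "e j v = P (the_inv_into {..<n} ((!) vs) v) j" for j v
  have e: "e j (vs ! i) = P i j" if "i < n" for i j
    using that bij by (simp add: e_def the_inv_into_f_f bij_betw_def)
  have sumV: "(\<Sum>v\<in>pverts G. h v) = (\<Sum>i<n. h (vs ! i))" for h :: "'a \<Rightarrow> real"
    using sum.reindex_bij_betw[OF bij, of h] by simp
  have coeff: "(\<Sum>v\<in>pverts G. u v * e j v) = (\<Sum>i<n. u (vs ! i) * P i j)" for u j
    unfolding sumV by (rule sum.cong) (simp_all add: e)
  have graph: "spectral_graph (pverts G) (\<lambda>a b. (a, b) \<in> parcs G) {..<n} e ((!) es) p"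
  proof
    show "finite (pverts G)" by (rule G.pair_finite_verts)
    show "(b, a) \<in> parcs G" if "(a, b) \<in> parcs G" for a b by (rule sym[OF that])
    show "(a, a) \<notin> parcs G" for a using G.no_loops' by blast
    show "p \<ge> 4" by (rule p)
    fix u :: "'a \<Rightarrow> real"
    let ?U = "\<lambda>i. u (vs ! i)"
    have "(\<Sum>j<n. (\<Sum>i<n. ?U i * P i j)\<^sup>2) = (\<Sum>i<n. \<Sum>k<n. ?U i * ?U k * (\<Sum>j<n. P i j * P k j))"
      using sum_of_scaled_squares[of "\<lambda>_. 1" ?U P "{..<n}" "{..<n}"] by simp
    also have "\<dots> = (\<Sum>i<n. \<Sum>k<n. if i = k then ?U i * ?U k else 0)"
      by (intro sum.cong refl) (simp add: rows)
    also have "\<dots> = (\<Sum>i<n. (?U i)\<^sup>2)" by (simp add: power2_eq_square)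
    finally show "(\<Sum>v\<in>pverts G. (u v)\<^sup>2) = (\<Sum>j<n. (\<Sum>v\<in>pverts G. u v * e j v)\<^sup>2)"
      unfolding coeff sumV by simp
    have "(\<Sum>v\<in>pverts G. \<Sum>w\<in>pverts G. of_bool ((v, w) \<in> parcs G) * u v * u w)
        = (\<Sum>i<n. \<Sum>k<n. ?U i * ?U k * (\<Sum>j<n. es ! j * (P i j * P k j)))"
      unfolding sumV by (intro sum.cong refl) (simp add: entries[symmetric] Aik)
    also have "\<dots> = (\<Sum>j<n. es ! j * (\<Sum>i<n. ?U i * P i j)\<^sup>2)"
      by (rule sum_of_scaled_squares[symmetric])
    finally show "(\<Sum>v\<in>pverts G. \<Sum>w\<in>pverts G. of_bool ((v, w) \<in> parcs G) * u v * u w)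
        = (\<Sum>j<n. es ! j * (\<Sum>v\<in>pverts G. u v * e j v)\<^sup>2)"
      unfolding coeff .
  qed
  interpret spectral_graph "pverts G" "\<lambda>a b. (a, b) \<in> parcs G" "{..<n}" e "(!) es" p by (rule graph)
  have "energy (pverts G) = (\<Sum>j<n. neg_power p (es ! j) * (\<Sum>i<n. (P i j)\<^sup>2))"
    unfolding energy_alt sumV by (intro sum.cong refl) (simp add: e)
  also have "\<dots> = (\<Sum>j<n. neg_power p (es ! j))" by (simp add: cols)
  also have "\<dots> = (\<Sum>j<length es. if es ! j < 0 then \<bar>es ! j\<bar> powr p else 0)"
    unfolding es by (intro sum.cong) (auto simp: neg_power_def)
  also have "\<dots> = negative_energy p G vs"
    unfolding negative_energy_def Let_def A_def[symmetric] sum_order_char_poly[OF A cp] ..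
  finally show thesis using that[OF graph[unfolded n_def]] unfolding n_def by blast
qed

theorem theorem1:
  fixes p :: real and n :: nat and G :: "'a pair_pre_digraph" and vs :: "'a list"
  assumes "p \<ge> 4"
    and "pair_graph G"
    and "Digraph_Component.connected (with_proj G)"
    and "card (pverts G) = n"
    and "\<not> complete_digraph n (with_proj G)"
    and "distinct vs" and "set vs = pverts G"
  shows "negative_energy p G vs \<ge> real n"
proof -
  interpret G: pair_graph G by (rule assms(2))
  obtain e lam where
    graph: "spectral_graph (pverts G) (\<lambda>a b. (a, b) \<in> parcs G) {..<length vs} e lam p"
    and en: "spectral_graph.energy {..<length vs} e lam p (pverts G) = negative_energy p G vs"
    using spectral_graph_of_adjacency_matrix[OF assms(1,2,6,7)] .
  interpret spectral_graph "pverts G" "\<lambda>a b. (a, b) \<in> parcs G" "{..<length vs}" e lam p by (rule graph)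
  have reach: "u \<rightarrow>\<^sup>*\<^bsub>with_proj (mk_symmetric (with_proj G))\<^esub> v"
    if "u \<in> pverts G" "v \<in> pverts G" for u v
    using assms(3) that unfolding connected_def strongly_connected_def by auto
  have "conn (pverts G)"
  proof (rule connI)
    show "pverts G \<noteq> {}" using assms(3) unfolding connected_def strongly_connected_def by simp
    fix A assume A: "A \<subseteq> pverts G" "A \<noteq> {}"
      and non: "\<And>a b. a \<in> A \<Longrightarrow> b \<in> pverts G - A \<Longrightarrow> (a, b) \<notin> parcs G"
    obtain a where a: "a \<in> A" using A by blast
    have "v \<in> A" if "v \<in> pverts G" for v
    proof -
      have "a \<rightarrow>\<^sup>*\<^bsub>with_proj (mk_symmetric (with_proj G))\<^esub> v" using reach a A that by blast
      then have "(a, v) \<in> rtrancl_on (pverts G) (parcs (mk_symmetric (with_proj G)))"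
        by (simp add: reachable_def)
      then show ?thesis
      proof (induction rule: rtrancl_on_induct)
        case base
        show ?case by (rule a)
      next
        case (step y z)
        have "(y, z) \<in> parcs G"
          using step.hyps(2) adj_sym by (auto simp: parcs_mk_symmetric)
        then show ?case using non[OF step.IH, of z] G.in_arcsD2 by blast
      qed
    qed
    then show "A = pverts G" using A(1) by blast
  qed
  moreover have "\<not> clique (pverts G)"
  proof
    assume "clique (pverts G)"
    then have "(a, b) \<in> parcs G \<longleftrightarrow> a \<in> pverts G \<and> b \<in> pverts G \<and> a \<noteq> b" for a b
      using G.in_arcsD1[of a b] G.in_arcsD2[of a b] adj_irrefl[of a] unfolding clique_def by metis
    then have "parcs G = {(u, v). (u, v) \<in> pverts G \<times> pverts G \<and> u \<noteq> v}" by auto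
    then have "complete_digraph n (with_proj G)"
      unfolding complete_digraph_pair_def using G.pair_finite_verts assms(4) by simp
    then show False using assms(5) by contradiction
  qed
  ultimately have "energy (pverts G) \<ge> real (card (pverts G))"
    by (rule energy_connected_noncomplete[OF subset_refl])
  then show ?thesis using en assms(4) by simp
qed

end
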